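(* Let $\{S_i\}_{i\in\mathcal{I}}$ be an IFS satisfying the weak separation condition, with attractor $K$. (i) If $U_0=U(x_0,t_0)$ is any open ball attaining the supremum in the weak separation condition, i.e. $\#\mathcal{S}_{t_0}(U(x_0,t_0))=\sup_{x\in\mathbb{R},t>0}\#\mathcal{S}_t(U(x,t))$, then $K\cap U_0$ is contained in a finite union of essential net intervals. In particular, $K\cap U_0\subseteq K_{\mathrm{ess}}$. (ii) If $\mu_{\mathbf p}$ is any associated self-similar measure, then $\mu_{\mathbf p}(K\setminus K_{\mathrm{ess}})=0$.
   Context: IFS. An iterated function system of similarities (IFS) is a finite set of maps $S_i(x)=r_ix+d_i$ on $\mathbb{R}$, $i\in\mathcal{I}$, with $0<|r_i|<1$ and $\#\mathcal{I}\ge 2$. Its attractor $K$ is the unique non-empty compact set with $K=\bigcup_{i}S_i(K)$. Standing assumptions: $K$ is not a singleton and (normalization) the convex hull of $K$ is $[0,1]$. Given $\mathbf p=(p_i)_{i\in\mathcal I}$ with $p_i>0$, $\sum p_i=1$, the associated self-similar measure $\mu_{\mathbf p}$ is the unique Borel probability measure with $\mu_{\mathbf p}(E)=\sum_i p_i\mu_{\mathbf p}(S_i^{-1}(E))$ for all Borel $E$. $\mathcal{I}^*$ is the set of finite words; for $\sigma=(\sigma_1,\dots,\sigma_n)$, $S_\sigma=S_{\sigma_1}\circ\cdots\circ S_{\sigma_n}$, $r_\sigma=\prod r_{\sigma_k}$, and $\sigma^-$ is $\sigma$ with the last letter deleted; for the empty word $S_\emptyset=\mathrm{id}$, $r_\emptyset=1$.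 For $t>0$, $\Lambda_t=\{\sigma\in\mathcal I^*:|r_\sigma|<t\le|r_{\sigma^-}|\}$ (convention: $|r_{\emptyset^-}|=\infty$, so $\Lambda_t=\{\emptyset\}$ for $t>1$). Weak separation condition. $U(x,t)$ is the open ball (interval) of centre $x$ and radius $t$. For Borel $E$, $\mathcal{S}_t(E)=\{S_\sigma:\sigma\in\Lambda_t,\ S_\sigma(K)\cap E\ne\emptyset\}$ (a set of functions). The weak separation condition is $\sup_{x\in\mathbb{R},t>0}\#\mathcal{S}_t(U(x,t))<\infty$. Net intervals. For $t>0$ let $h_1<\dots<h_{s(t)}$ be the distinct elements of $\{S_\sigma(0),S_\sigma(1):\sigma\in\Lambda_t\}$. The net intervals of generation $t$ are the elements of $\mathcal{F}_t=\{[h_j,h_{j+1}]:1\le j<s(t),\ (h_j,h_{j+1})\cap K\ne\emptyset\}$. A net interval is always considered together with its generation. $T_\Delta(x)=rx+a$ is the map with $r>0$ and $T_\Delta([0,1])=\Delta$. The neighbour set of $\Delta\in\mathcal F_t$ is $\mathcal V(\Delta)=\mathcal{V}_t(\Delta)=\{T_\Delta^{-1}\circ S_\sigma:\sigma\in\Lambda_t,\ S_\sigma(K)\cap\Delta^\circ\neq\emptyset\}$ (a set of functions, called neighbours). The transition generation is $\operatorname{tg}(\Delta)=\diam(\Delta)\cdot\max\{|R|:(x\mapsto Rx+a)\in\mathcal V(\Delta)\}$, where $\operatorname{diam}$ is the diameter; the children of $\Delta$ are the net intervals of generation $\operatorname{tg}(\Delta)$ contained in $\Delta$; $\Delta$ is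 the parent of its children. The position index of a child $\Delta'=[a',b']$ of $\Delta=[a,b]$ is $q(\Delta,\Delta')=(a'-a)/\operatorname{diam}(\Delta)$. Transition graph. $\mathcal G$ is the directed graph (loops, multiple edges allowed) with vertices the distinct neighbour sets of net intervals, and with an edge $(\mathcal V(\Delta),\mathcal V(\Delta'),q(\Delta,\Delta'))$ from $\mathcal V(\Delta)$ to $\mathcal V(\Delta')$ for each net interval $\Delta$ and child $\Delta'$ of $\Delta$ (the outgoing edges depend only on $\mathcal V(\Delta)$). A path is a sequence of consecutive edges. A symbolic representation of $x\in K$ is the infinite path $(e_i)_{i\ge1}$, $e_i=(\mathcal V(\Delta_{i-1}),\mathcal V(\Delta_i),q(\Delta_{i-1},\Delta_i))$, given by a sequence $\Delta_0=[0,1]$ (of generation $>1$), $\Delta_i$ a child of $\Delta_{i-1}$, $\{x\}=\bigcap_i\Delta_i$. An essential class is a (non-empty) induced subgraph $\mathcal G'$ such that any two vertices $v,v'$ of $\mathcal G'$ are joined by a path from $v$ to $v'$, and any vertex of $\mathcal G$ reachable by a path from a vertex of $\mathcal G'$ is in $\mathcal G'$. Under the weak separation condition, $\mathcal G$ has a unique essential class $\mathcal G_{\mathrm{ess}}$. A net interval $\Delta$ is essential if $\mathcal V(\Delta)$ is a vertex of $\mathcal G_{\mathrm{ess}}$. $K_{\mathrm{ess}}$ (the interior essential points) is the set of $x\in K$ such that every symbolic representation $(e_j)$ of $x$ has all $e_k$, $k\ge N$, edges of $\mathcal G_{\mathrm{ess}}$ for some $N$. *)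

theory Defs
  imports "Graph_Theory.Digraph_Component" "HOL-Probability.Probability"
begin

text \<open>
  The maps are given as a finite indexed family, so distinct indices may carry the same map.
\<close>

locale ifs =
  fixes I :: "'i set" and r :: "'i \<Rightarrow> real" and d :: "'i \<Rightarrow> real" and K :: "real set"
  assumes finite_I: "finite I"
    and card_I: "2 \<le> card I"
    and ratio: "\<And>i. i \<in> I \<Longrightarrow> 0 < \<bar>r i\<bar> \<and> \<bar>r i\<bar> < 1"
    and K_compact: "compact K"
    and K_nonempty: "K \<noteq> {}"
    and K_invariant: "K = (\<Union>i\<in>I. (\<lambda>x. r i * x + d i) ` K)"
    and K_not_singleton: "\<And>x. K \<noteq> {x}"
    and K_hull: "convex hull K = {0..1}"
begin

definition S :: "'i \<Rightarrow> real \<Rightarrow> real" where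
  "S i = (\<lambda>x. r i * x + d i)"

definition self_similar_measure :: "('i \<Rightarrow> real) \<Rightarrow> real measure \<Rightarrow> bool" where
  "self_similar_measure p \<mu> \<longleftrightarrow>
     (\<forall>i\<in>I. 0 < p i) \<and> (\<Sum>i\<in>I. p i) = 1 \<and>
     prob_space \<mu> \<and> sets \<mu> = sets borel \<and>
     (\<forall>E\<in>sets borel. measure \<mu> E = (\<Sum>i\<in>I. p i * measure \<mu> (S i -` E)))"

definition S_word :: "'i list \<Rightarrow> real \<Rightarrow> real" where
  "S_word \<sigma> = foldr (\<lambda>i f. S i \<circ> f) \<sigma> id"

definition r_word :: "'i list \<Rightarrow> real" where
  "r_word \<sigma> = prod_list (map r \<sigma>)"

text \<open>The case \<open>\<sigma> = []\<close> encodes the convention that the parent of the empty word has ratio \<open>\<infinity>\<close>.\<close>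

definition \<Lambda> :: "real \<Rightarrow> 'i list set" where
  "\<Lambda> t = {\<sigma> \<in> lists I. \<bar>r_word \<sigma>\<bar> < t \<and> (\<sigma> = [] \<or> t \<le> \<bar>r_word (butlast \<sigma>)\<bar>)}"

definition maps_meeting :: "real \<Rightarrow> real set \<Rightarrow> (real \<Rightarrow> real) set" where
  "maps_meeting t E = {S_word \<sigma> |\<sigma>. \<sigma> \<in> \<Lambda> t \<and> S_word \<sigma> ` K \<inter> E \<noteq> {}}"

text \<open>
  For \<open>t > 0\<close> the set \<open>\<Lambda> t\<close> is finite, so every cardinality below is that of a finite set.
\<close>

definition separation_sup :: enat where
  "separation_sup = (SUP (x, t) \<in> UNIV \<times> {0<..}. enat (card (maps_meeting t (ball x t))))"

definition weak_separation :: bool where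
  "weak_separation \<longleftrightarrow> separation_sup < \<infinity>"

definition endpoints :: "real \<Rightarrow> real set" where
  "endpoints t = (\<Union>\<sigma>\<in>\<Lambda> t. {S_word \<sigma> 0, S_word \<sigma> 1})"

text \<open>
  Net intervals are pairs of a generation and an interval. The endpoints of the interval are
  consecutive elements \<open>h\<^sub>j < h\<^sub>j\<^sub>+\<^sub>1\<close> of the finite set \<open>endpoints t\<close>.
\<close>

definition net_intervals :: "(real \<times> real set) set" where
  "net_intervals = {(t, {a..b}) |t a b. 0 < t \<and> a \<in> endpoints t \<and> b \<in> endpoints t \<and> a < b \<and>
     endpoints t \<inter> {a<..<b} = {} \<and> {a<..<b} \<inter> K \<noteq> {}}"

definition T :: "real set \<Rightarrow> real \<Rightarrow> real" where
  "T \<Delta> = (\<lambda>x. diameter \<Delta> * x + Inf \<Delta>)"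

fun \<V> :: "real \<times> real set \<Rightarrow> (real \<Rightarrow> real) set" where
  "\<V> (t, \<Delta>) = {inv (T \<Delta>) \<circ> S_word \<sigma> |\<sigma>. \<sigma> \<in> \<Lambda> t \<and> S_word \<sigma> ` K \<inter> interior \<Delta> \<noteq> {}}"

fun tg :: "real \<times> real set \<Rightarrow> real" where
  "tg (t, \<Delta>) = diameter \<Delta> * Max {\<bar>R\<bar> |R a. (\<lambda>x. R * x + a) \<in> \<V> (t, \<Delta>)}"

definition children :: "real \<times> real set \<Rightarrow> (real \<times> real set) set" where
  "children N = {N' \<in> net_intervals. fst N' = tg N \<and> snd N' \<subseteq> snd N}"

definition position_index :: "real \<times> real set \<Rightarrow> real \<times> real set \<Rightarrow> real" where
  "position_index N N' = (Inf (snd N') - Inf (snd N)) / diameter (snd N)"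

definition edge ::
  "real \<times> real set \<Rightarrow> real \<times> real set \<Rightarrow> (real \<Rightarrow> real) set \<times> (real \<Rightarrow> real) set \<times> real" where
  "edge N N' = (\<V> N, \<V> N', position_index N N')"

definition transition_graph ::
  "((real \<Rightarrow> real) set, (real \<Rightarrow> real) set \<times> (real \<Rightarrow> real) set \<times> real) pre_digraph" where
  "transition_graph =
     \<lparr>verts = \<V> ` net_intervals,
      arcs = {edge N N' |N N'. N \<in> net_intervals \<and> N' \<in> children N},
      tail = (\<lambda>e. fst e),
      head = (\<lambda>e. fst (snd e))\<rparr>"

definition essential_class ::
  "((real \<Rightarrow> real) set, (real \<Rightarrow> real) set \<times> (real \<Rightarrow> real) set \<times> real) pre_digraph \<Rightarrow> bool" where
  "essential_class H \<longleftrightarrow> induced_subgraph H transition_graph \<and> strongly_connected H \<and>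
     (\<forall>u\<in>verts H. \<forall>v. u \<rightarrow>\<^sup>*\<^bsub>transition_graph\<^esub> v \<longrightarrow> v \<in> verts H)"

text \<open>The essential class exists and is unique under the weak separation condition.\<close>

definition G_ess ::
  "((real \<Rightarrow> real) set, (real \<Rightarrow> real) set \<times> (real \<Rightarrow> real) set \<times> real) pre_digraph" where
  "G_ess = (THE H. essential_class H)"

definition essential :: "real \<times> real set \<Rightarrow> bool" where
  "essential N \<longleftrightarrow> N \<in> net_intervals \<and> \<V> N \<in> verts G_ess"

text \<open>The edge written \<open>e\<^sub>i\<close> in the usual indexing from \<open>1\<close> is \<open>e (i - 1)\<close> here.\<close>

definition symbolic_representation ::
  "real \<Rightarrow> (nat \<Rightarrow> (real \<Rightarrow> real) set \<times> (real \<Rightarrow> real) set \<times> real) \<Rightarrow> bool" where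
  "symbolic_representation x e \<longleftrightarrow>
     (\<exists>N. 1 < fst (N 0) \<and> snd (N 0) = {0..1} \<and> (\<forall>n. N (Suc n) \<in> children (N n)) \<and>
          (\<Inter>n. snd (N n)) = {x} \<and> (\<forall>n. e n = edge (N n) (N (Suc n))))"

definition K_ess :: "real set" where
  "K_ess = {x \<in> K. \<forall>e. symbolic_representation x e \<longrightarrow> (\<exists>m. \<forall>k\<ge>m. e k \<in> arcs G_ess)}"

end

end

theory Submission
  imports Defs
begin

text \<open>
  Let \<open>U(x\<^sub>0, t\<^sub>0)\<close> attain the supremum. For a word \<open>\<tau>\<close>, composition with \<open>S\<^sub>\<tau>\<close> maps the functions
  meeting \<open>U(x\<^sub>0, t\<^sub>0)\<close> injectively to those meeting \<open>S\<^sub>\<tau>(U(x\<^sub>0, t\<^sub>0))\<close> at generation \<open>|r\<^sub>\<tau>| t\<^sub>0\<close>; by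
  maximality it is onto, so the image ball attains the supremum too and the net intervals inside it
  are the images of those inside \<open>U(x\<^sub>0, t\<^sub>0)\<close>, with the same neighbour sets when \<open>r\<^sub>\<tau> > 0\<close>. Every net
  interval contains such an image as a descendant, hence the neighbour set of a net interval inside
  \<open>U(x\<^sub>0, t\<^sub>0)\<close> is reachable from every vertex, which makes it essential. Since
  the balls \<open>U(y, t\<^sub>0)\<close> with \<open>y\<close> near \<open>x\<^sub>0\<close> also attain the supremum, small net intervals that merely
  meet \<open>U(x\<^sub>0, t\<^sub>0)\<close> are essential as well.

  The points of \<open>K\<close> outside all the balls \<open>S\<^sub>\<tau>(U(x\<^sub>0, t\<^sub>0))\<close> form a closed set \<open>E\<close> with
  \<open>S\<^sub>\<sigma>\<^sup>-\<^sup>1(E) \<inter> K \<subseteq> E\<close>. Self-similarity then forces all preimages \<open>S\<^sub>\<sigma>\<^sup>-\<^sup>1(E)\<close> to have the measure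
  of \<open>E\<close>, and one of them misses \<open>K\<close>. Finally, \<open>K - K_ess\<close> is Borel because it is closed, by
  Koenig's lemma applied to the tree of inessential net intervals.
\<close>

section \<open>Two general facts: walks in closed vertex sets, and averages that attain their
  bound\<close>

text \<open>Every arc of the walk has its tail in \<open>V\<close>, hence its head too, so no arc is
  lost in the induced subgraph. This yields strong connectivity of the essential class.\<close>

lemma (in wf_digraph) reachable_in_closed:
  assumes "u \<rightarrow>\<^sup>* v" "u \<in> V" "\<And>x y. x \<in> V \<Longrightarrow> x \<rightarrow>\<^bsub>G\<^esub> y \<Longrightarrow> y \<in> V"
  shows "v \<in> V" "u \<rightarrow>\<^sup>*\<^bsub>induce_subgraph G V\<^esub> v"
proof -
  interpret H: wf_digraph "induce_subgraph G V" by (rule wellformed_induce_subgraph)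
  have "v \<in> V \<and> u \<rightarrow>\<^sup>*\<^bsub>induce_subgraph G V\<^esub> v"
    using assms(1)
  proof (induction rule: reachable_induct)
    case base
    then show ?case using assms(2) by (auto intro: H.reachable_refl)
  next
    case (step x y)
    then have "y \<in> V" using assms(3) by blast
    moreover have "x \<rightarrow>\<^bsub>induce_subgraph G V\<^esub> y"
      using step \<open>y \<in> V\<close> by (auto simp: arcs_ends_conv image_iff)
    ultimately show ?case using step H.reachable_adj_trans by blast
  qed
  then show "v \<in> V" "u \<rightarrow>\<^sup>*\<^bsub>induce_subgraph G V\<^esub> v" by auto
qed

text \<open>The gaps \<open>m - f i\<close> are nonnegative and average to zero with positive
  weights.\<close>

lemma weighted_average_extremal:
  fixes p f :: "'a \<Rightarrow> real"
  assumes "finite A" "\<And>i. i \<in> A \<Longrightarrow> 0 < p i" "sum p A = 1" "(\<Sum>i\<in>A. p i * f i) = m"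
    "\<And>i. i \<in> A \<Longrightarrow> f i \<le> m" "i \<in> A"
  shows "f i = m"
proof -
  have "(\<Sum>i\<in>A. p i * (m - f i)) = sum p A * m - (\<Sum>i\<in>A. p i * f i)"
    by (simp add: right_diff_distrib sum_subtractf sum_distrib_right)
  then have zero: "(\<Sum>i\<in>A. p i * (m - f i)) = 0" using assms(3,4) by simp
  have nonneg: "0 \<le> p i * (m - f i)" if "i \<in> A" for i
    using assms(2)[OF that] assms(5)[OF that] by simp
  have "p i * (m - f i) = 0" using sum_nonneg_0[OF assms(1) nonneg zero assms(6)] .
  then show ?thesis using assms(2)[OF assms(6)] by simp
qed

context ifs
begin

subsection \<open>Words\<close>

lemma S_word_Nil [simp]: "S_word [] = id"
  and S_word_Cons [simp]: "S_word (i # \<sigma>) = S i \<circ> S_word \<sigma>"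
  and r_word_Nil [simp]: "r_word [] = 1"
  and r_word_Cons [simp]: "r_word (i # \<sigma>) = r i * r_word \<sigma>"
  by (simp_all add: S_word_def r_word_def)

lemma S_word_append: "S_word (\<sigma> @ \<tau>) = S_word \<sigma> \<circ> S_word \<tau>"
  by (induction \<sigma>) (auto simp: o_assoc)

lemma r_word_append [simp]: "r_word (\<sigma> @ \<tau>) = r_word \<sigma> * r_word \<tau>"
  by (induction \<sigma>) (auto simp: mult.assoc)

lemma S_word_affine: "S_word \<sigma> x = r_word \<sigma> * x + S_word \<sigma> 0"
proof (induction \<sigma> arbitrary: x)
  case (Cons i \<sigma>)
  have "S_word \<sigma> x = r_word \<sigma> * x + S_word \<sigma> 0" by (rule Cons)
  then show ?case by (simp add: S_def algebra_simps)
qed simp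

lemma S_word_diff: "S_word \<sigma> x - S_word \<sigma> y = r_word \<sigma> * (x - y)"
  using S_word_affine[of \<sigma> x] S_word_affine[of \<sigma> y] by (simp add: algebra_simps)

lemma r_word_pos: "\<sigma> \<in> lists I \<Longrightarrow> 0 < \<bar>r_word \<sigma>\<bar>"
  by (induction \<sigma>) (use ratio in \<open>auto simp: abs_mult\<close>)

lemma r_word_nonzero: "\<sigma> \<in> lists I \<Longrightarrow> r_word \<sigma> \<noteq> 0"
  using r_word_pos by force

lemma r_word_le_one: "\<sigma> \<in> lists I \<Longrightarrow> \<bar>r_word \<sigma>\<bar> \<le> 1"
proof (induction \<sigma>)
  case (Cons i \<sigma>)
  then show ?case using ratio[of i] by (auto simp: abs_mult intro!: mult_le_one)
qed simp

lemma inj_S_word: "\<sigma> \<in> lists I \<Longrightarrow> inj (S_word \<sigma>)"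
  by (rule injI) (metis S_word_diff eq_iff_diff_eq_0 mult_eq_0_iff r_word_nonzero)

lemma I_nonempty: "I \<noteq> {}"
  using card_I by auto

lemma contraction_bound:
  obtains \<rho> where "0 < \<rho>" "\<rho> < 1" "\<forall>i\<in>I. \<bar>r i\<bar> \<le> \<rho>"
proof
  let ?M = "Max ((\<lambda>i. \<bar>r i\<bar>) ` I)"
  have "?M \<in> (\<lambda>i. \<bar>r i\<bar>) ` I"
    using finite_I I_nonempty by (intro Max_in) auto
  then show "0 < ?M" "?M < 1" using ratio by auto
  show "\<forall>i\<in>I. \<bar>r i\<bar> \<le> ?M" using finite_I by auto
qed

lemma long_words_small:
  assumes "0 < t"
  obtains n where "\<forall>\<sigma>\<in>lists I. n \<le> length \<sigma> \<longrightarrow> \<bar>r_word \<sigma>\<bar> < t"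
proof -
  obtain \<rho> where \<rho>: "0 < \<rho>" "\<rho> < 1" "\<forall>i\<in>I. \<bar>r i\<bar> \<le> \<rho>"
    by (rule contraction_bound)
  have le: "\<bar>r_word \<sigma>\<bar> \<le> \<rho> ^ length \<sigma>" if "\<sigma> \<in> lists I" for \<sigma>
    using that by (induction \<sigma>) (use \<rho> in \<open>auto simp: abs_mult intro!: mult_mono\<close>)
  obtain n where n: "\<rho> ^ n < t"
    using real_arch_pow_inv[OF assms \<rho>(2)] by blast
  show ?thesis
  proof (rule that[of n], intro ballI impI)
    fix \<sigma> assume "\<sigma> \<in> lists I" "n \<le> length \<sigma>"
    moreover from this have "\<rho> ^ length \<sigma> \<le> \<rho> ^ n" using \<rho> by (intro power_decreasing) auto
    ultimately show "\<bar>r_word \<sigma>\<bar> < t" using le[of \<sigma>] n by linarith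
  qed
qed

text \<open>All letters contract by a common factor below one, so long words have small ratio.
  Besides finiteness of \<open>\<Lambda> t\<close>, this bounds how many generations a chain of
  children can pass above a positive level.\<close>

lemma finite_large_words:
  assumes "0 < t" shows "finite {\<sigma> \<in> lists I. t \<le> \<bar>r_word \<sigma>\<bar>}"
proof -
  obtain n where n: "\<forall>\<sigma>\<in>lists I. n \<le> length \<sigma> \<longrightarrow> \<bar>r_word \<sigma>\<bar> < t"
    by (rule long_words_small[OF assms])
  have "{\<sigma> \<in> lists I. t \<le> \<bar>r_word \<sigma>\<bar>} \<subseteq> {\<sigma>. set \<sigma> \<subseteq> I \<and> length \<sigma> \<le> n}"
    using n by (force simp: in_lists_conv_set)
  then show ?thesis
    using finite_lists_length_le[OF finite_I] finite_subset by blast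
qed

lemma \<Lambda>_lists: "\<sigma> \<in> \<Lambda> t \<Longrightarrow> \<sigma> \<in> lists I"
  by (simp add: \<Lambda>_def)

lemma finite_\<Lambda>: assumes "0 < t" shows "finite (\<Lambda> t)"
proof -
  let ?L = "{\<sigma> \<in> lists I. t \<le> \<bar>r_word \<sigma>\<bar>}"
  have "\<sigma> \<in> insert [] ((\<lambda>(\<sigma>, i). \<sigma> @ [i]) ` (?L \<times> I))" if "\<sigma> \<in> \<Lambda> t" for \<sigma>
    using that
  proof (cases \<sigma> rule: rev_cases)
    case (snoc \<sigma>' i)
    with that show ?thesis by (auto simp: \<Lambda>_def image_iff)
  qed simp
  then show ?thesis
    using finite_large_words[OF assms] finite_I
    by (meson finite_SigmaI finite_imageI finite_insert finite_subset subsetI)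
qed

lemma prefix_in_\<Lambda>:
  assumes "\<sigma> \<in> lists I" "\<bar>r_word \<sigma>\<bar> < t"
  shows "\<exists>\<pi> \<eta>. \<sigma> = \<pi> @ \<eta> \<and> \<pi> \<in> \<Lambda> t \<and> \<eta> \<in> lists I"
  using assms
proof (induction \<sigma> rule: rev_induct)
  case Nil
  then show ?case by (auto simp: \<Lambda>_def)
next
  case (snoc i \<sigma>)
  show ?case
  proof (cases "\<bar>r_word \<sigma>\<bar> < t")
    case True
    with snoc obtain \<pi> \<eta> where "\<sigma> = \<pi> @ \<eta>" "\<pi> \<in> \<Lambda> t" "\<eta> \<in> lists I" by auto
    then show ?thesis using snoc.prems by (intro exI[of _ \<pi>] exI[of _ "\<eta> @ [i]"]) auto
  next
    case False
    then show ?thesis using snoc.prems by (intro exI[of _ "\<sigma> @ [i]"] exI[of _ "[]"]) (auto simp: \<Lambda>_def)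
  qed
qed

lemma \<Lambda>_prefix_free:
  assumes "\<pi> @ \<eta> \<in> \<Lambda> t" "\<pi> \<in> \<Lambda> t" shows "\<eta> = []"
proof (cases \<eta> rule: rev_cases)
  case (snoc \<eta>' i)
  \<comment> \<open>The parent of \<open>\<pi> @ \<eta>\<close> still has \<open>\<pi>\<close> as a
    prefix, so its ratio would be below \<open>t\<close>.\<close>
  with assms have "t \<le> \<bar>r_word \<pi>\<bar> * \<bar>r_word \<eta>'\<bar>" "\<bar>r_word \<pi>\<bar> < t" "\<bar>r_word \<eta>'\<bar> \<le> 1"
    using r_word_le_one[of \<eta>'] by (auto simp: \<Lambda>_def abs_mult butlast_append)
  then have False using mult_left_le[of "\<bar>r_word \<eta>'\<bar>" "\<bar>r_word \<pi>\<bar>"] by auto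
  then show ?thesis ..
qed

lemma \<Lambda>_nonempty_word: "\<sigma> \<in> \<Lambda> t \<Longrightarrow> t \<le> 1 \<Longrightarrow> \<sigma> \<noteq> []"
  by (auto simp: \<Lambda>_def)

text \<open>\<open>u \<le> 1\<close> makes \<open>\<eta>\<close> nonempty, so deleting the last
  letter of \<open>\<tau> @ \<eta>\<close> affects only \<open>\<eta>\<close>, and both defining
  inequalities scale by \<open>\<bar>r_word \<tau>\<bar>\<close>.\<close>

lemma append_in_\<Lambda>:
  assumes "\<eta> \<in> \<Lambda> u" "u \<le> 1" "\<tau> \<in> lists I"
  shows "\<tau> @ \<eta> \<in> \<Lambda> (\<bar>r_word \<tau>\<bar> * u)"
  using assms \<Lambda>_nonempty_word[OF assms(1,2)] r_word_pos[OF assms(3)]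
  by (auto simp: \<Lambda>_def abs_mult butlast_append)

subsection \<open>The attractor\<close>

lemma K_subset: "K \<subseteq> {0..1}"
  using hull_subset[of K convex] K_hull by simp

lemma zero_in_K: "0 \<in> K"
proof (rule ccontr)
  assume "0 \<notin> K"
  with K_subset have "K \<subseteq> {0<..1}" by (force simp: less_eq_real_def)
  then have "convex hull K \<subseteq> {0<..1}" by (intro hull_minimal) auto
  then have "(0::real) \<in> {0<..1}" unfolding K_hull by (rule subsetD) simp
  then show False by simp
qed

lemma one_in_K: "1 \<in> K"
proof (rule ccontr)
  assume "1 \<notin> K"
  with K_subset have "K \<subseteq> {0..<1}" by (force simp: less_eq_real_def)
  then have "convex hull K \<subseteq> {0..<1}" by (intro hull_minimal) auto
  then have "(1::real) \<in> {0..<1}" unfolding K_hull by (rule subsetD) simp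
  then show False by simp
qed

lemma K_closed: "closed K"
  using K_compact compact_imp_closed by blast

lemma S_image_K: "i \<in> I \<Longrightarrow> S i ` K \<subseteq> K"
  using K_invariant by (auto simp: S_def)

lemma S_word_K: "\<sigma> \<in> lists I \<Longrightarrow> x \<in> K \<Longrightarrow> S_word \<sigma> x \<in> K"
  by (induction \<sigma>) (use S_image_K in auto)

lemma K_cover_length:
  "x \<in> K \<Longrightarrow> \<exists>\<sigma>\<in>lists I. length \<sigma> = n \<and> x \<in> S_word \<sigma> ` K"
proof (induction n arbitrary: x)
  case (Suc n)
  obtain i y where i: "i \<in> I" "y \<in> K" "x = S i y"
    using Suc.prems by (subst (asm) K_invariant) (auto simp: S_def)
  then obtain \<sigma> where "\<sigma> \<in> lists I" "length \<sigma> = n" "y \<in> S_word \<sigma> ` K"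
    using Suc.IH by blast
  with i show ?case by (intro bexI[of _ "i # \<sigma>"]) auto
qed auto

lemma K_cover_small:
  assumes "x \<in> K" "0 < t"
  obtains \<sigma> where "\<sigma> \<in> lists I" "x \<in> S_word \<sigma> ` K" "\<bar>r_word \<sigma>\<bar> < t"
  using long_words_small[OF assms(2)] K_cover_length[OF assms(1)] by (metis order_refl)

lemma K_cover_\<Lambda>:
  assumes "x \<in> K" "0 < t"
  obtains \<sigma> where "\<sigma> \<in> \<Lambda> t" "x \<in> S_word \<sigma> ` K"
proof -
  obtain \<sigma> where \<sigma>: "\<sigma> \<in> lists I" "x \<in> S_word \<sigma> ` K" "\<bar>r_word \<sigma>\<bar> < t"
    using K_cover_small[OF assms] .
  obtain \<pi> \<eta> where "\<sigma> = \<pi> @ \<eta>" "\<pi> \<in> \<Lambda> t" "\<eta> \<in> lists I"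
    using prefix_in_\<Lambda>[OF \<sigma>(1,3)] by blast
  with \<sigma>(2) show ?thesis by (intro that[of \<pi>]) (auto simp: S_word_append intro: S_word_K)
qed

text \<open>Either \<open>\<pi>\<close> already has ratio below \<open>s\<close>, or
  \<open>y\<close> is covered at the rescaled generation
  \<open>s / \<bar>r_word \<pi>\<bar>\<close>, which is at most one, so that
  \<open>append_in_\<Lambda>\<close> applies.\<close>

lemma extend_to_\<Lambda>:
  assumes "\<pi> \<in> \<Lambda> t" "0 < s" "s \<le> t" "y \<in> K"
  obtains \<eta> where "\<eta> \<in> lists I" "\<pi> @ \<eta> \<in> \<Lambda> s" "y \<in> S_word \<eta> ` K"
proof (cases "\<bar>r_word \<pi>\<bar> < s")
  case True
  with assms show ?thesis by (intro that[of "[]"]) (auto simp: \<Lambda>_def)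
next
  case False
  have pos: "0 < \<bar>r_word \<pi>\<bar>" using assms \<Lambda>_lists r_word_pos by blast
  let ?u = "s / \<bar>r_word \<pi>\<bar>"
  have u: "0 < ?u" "?u \<le> 1" "\<bar>r_word \<pi>\<bar> * ?u = s" using False pos assms by auto
  obtain \<eta> where "\<eta> \<in> \<Lambda> ?u" "y \<in> S_word \<eta> ` K" using K_cover_\<Lambda>[OF assms(4) u(1)] .
  with append_in_\<Lambda>[of \<eta> ?u \<pi>] u assms(1) show ?thesis
    by (intro that[of \<eta>]) (auto dest: \<Lambda>_lists)
qed

lemma S_word_unit: "\<sigma> \<in> lists I \<Longrightarrow> x \<in> {0..1} \<Longrightarrow> S_word \<sigma> x \<in> {0..1}"
proof -
  assume *: "\<sigma> \<in> lists I" "x \<in> {0..1}"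
  have "S_word \<sigma> x = (1 - x) * S_word \<sigma> 0 + x * S_word \<sigma> 1"
    using S_word_affine[of \<sigma> x] S_word_affine[of \<sigma> 1] by (simp add: algebra_simps)
  moreover have "S_word \<sigma> 0 \<in> {0..1}" "S_word \<sigma> 1 \<in> {0..1}"
    using S_word_K[OF *(1)] K_subset zero_in_K one_in_K by blast+
  ultimately show ?thesis using * convex_bound_le[of "S_word \<sigma> 0" 1 "S_word \<sigma> 1" "1-x" x] by auto
qed

text \<open>\<open>S_word \<sigma>\<close> is strictly monotone and sends \<open>{0..1}\<close> into
  itself, so the image of an interior point lies strictly between two points of
  \<open>{0..1}\<close>.\<close>

lemma S_word_extreme:
  assumes "\<sigma> \<in> lists I" "z \<in> {0..1}" "S_word \<sigma> z \<in> {0, 1}"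
  shows "z \<in> {0, 1}"
proof (rule ccontr)
  assume "z \<notin> {0, 1}"
  then have z: "0 < z" "z < 1" using assms by auto
  have 0: "S_word \<sigma> z - S_word \<sigma> 0 = r_word \<sigma> * z" "S_word \<sigma> 1 - S_word \<sigma> z = r_word \<sigma> * (1 - z)"
    using S_word_diff[of \<sigma> z 0] S_word_diff[of \<sigma> 1 z] by auto
  have "S_word \<sigma> 0 \<in> {0..1}" "S_word \<sigma> 1 \<in> {0..1}" using S_word_unit[OF assms(1)] by auto
  moreover have "r_word \<sigma> > 0 \<or> r_word \<sigma> < 0" using r_word_nonzero[OF assms(1)] by auto
  then have "r_word \<sigma> * z > 0 \<and> r_word \<sigma> * (1 - z) > 0 \<or> r_word \<sigma> * z < 0 \<and> r_word \<sigma> * (1 - z) < 0"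
    using z by (auto simp: mult_pos_pos mult_neg_pos)
  ultimately show False using 0 assms(3) by auto
qed

lemma S_word_between:
  assumes "x \<in> {0..1}"
  shows "min (S_word \<sigma> 0) (S_word \<sigma> 1) \<le> S_word \<sigma> x" "S_word \<sigma> x \<le> max (S_word \<sigma> 0) (S_word \<sigma> 1)"
proof -
  have eq: "S_word \<sigma> x = (1 - x) * S_word \<sigma> 0 + x * S_word \<sigma> 1"
    using S_word_affine[of \<sigma> x] S_word_affine[of \<sigma> 1] by (simp add: algebra_simps)
  show "S_word \<sigma> x \<le> max (S_word \<sigma> 0) (S_word \<sigma> 1)"
    unfolding eq using assms by (intro convex_bound_le) auto
  have "- S_word \<sigma> x \<le> - min (S_word \<sigma> 0) (S_word \<sigma> 1)"
    unfolding eq using assms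
      convex_bound_le[of "- S_word \<sigma> 0" "- min (S_word \<sigma> 0) (S_word \<sigma> 1)" "- S_word \<sigma> 1" "1 - x" x]
    by auto
  then show "min (S_word \<sigma> 0) (S_word \<sigma> 1) \<le> S_word \<sigma> x" by simp
qed

text \<open>A word of small ratio whose image contains \<open>x\<close> places the distinct points
  \<open>S_word \<sigma> 0\<close> and \<open>S_word \<sigma> 1\<close> of \<open>K\<close> near
  \<open>x\<close>; one of them differs from \<open>x\<close>.\<close>

lemma K_perfect:
  assumes "x \<in> K" "0 < e"
  obtains y where "y \<in> K" "y \<noteq> x" "\<bar>y - x\<bar> < e"
proof -
  obtain \<sigma> z where \<sigma>: "\<sigma> \<in> lists I" "z \<in> K" "x = S_word \<sigma> z" "\<bar>r_word \<sigma>\<bar> < e"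
    using K_cover_small[OF assms] by blast
  have near: "\<bar>S_word \<sigma> w - x\<bar> < e" if "w \<in> {0..1}" for w
  proof -
    have "\<bar>S_word \<sigma> w - x\<bar> = \<bar>r_word \<sigma>\<bar> * \<bar>w - z\<bar>"
      using S_word_diff[of \<sigma> w z] \<sigma> by (simp add: abs_mult)
    also have "\<dots> \<le> \<bar>r_word \<sigma>\<bar> * 1"
      using that subsetD[OF K_subset \<sigma>(2)] by (intro mult_left_mono) auto
    finally show ?thesis using \<sigma> by simp
  qed
  have "S_word \<sigma> 0 \<noteq> S_word \<sigma> 1"
    using inj_S_word[OF \<sigma>(1)] by (metis injD zero_neq_one)
  then have "S_word \<sigma> 0 \<noteq> x \<or> S_word \<sigma> 1 \<noteq> x" by auto
  then show ?thesis
    using that[OF S_word_K[OF \<sigma>(1) zero_in_K]] that[OF S_word_K[OF \<sigma>(1) one_in_K]] near[of 0] near[of 1]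
    by force
qed

subsection \<open>Net intervals\<close>

definition words_meeting :: "real \<Rightarrow> real set \<Rightarrow> 'i list set" where
  "words_meeting t E = {\<sigma> \<in> \<Lambda> t. S_word \<sigma> ` K \<inter> E \<noteq> {}}"

lemma maps_meeting_eq: "maps_meeting t E = S_word ` words_meeting t E"
  by (auto simp: maps_meeting_def words_meeting_def)

lemma finite_words_meeting: "0 < t \<Longrightarrow> finite (words_meeting t E)"
  using finite_\<Lambda> by (simp add: words_meeting_def)

lemma words_meeting_nonempty:
  assumes "0 < t" "K \<inter> E \<noteq> {}" shows "words_meeting t E \<noteq> {}"
proof -
  obtain x where "x \<in> K" "x \<in> E" using assms by auto
  with K_cover_\<Lambda>[of x t] assms(1) obtain \<sigma> where "\<sigma> \<in> \<Lambda> t" "x \<in> S_word \<sigma> ` K" by blast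
  with \<open>x \<in> E\<close> show ?thesis by (auto simp: words_meeting_def)
qed

lemma inv_T: assumes "a < b" shows "inv (T {a..b}) y = (y - a) / (b - a)"
  by (rule inv_f_eq) (use assms in \<open>auto simp: T_def inj_def\<close>)

declare \<V>.simps [simp del] tg.simps [simp del]

lemma \<V>_eq:
  assumes "a < b"
  shows "\<V> (t, {a..b}) = (\<lambda>\<sigma> x. (S_word \<sigma> x - a) / (b - a)) ` words_meeting t {a<..<b}"
proof -
  have "inv (T {a..b}) \<circ> S_word \<sigma> = (\<lambda>x. (S_word \<sigma> x - a) / (b - a))" for \<sigma>
    using inv_T[OF assms] by auto
  then show ?thesis
    unfolding \<V>.simps words_meeting_def interior_atLeastAtMost_real by auto
qed

lemma tg_eq:
  assumes "a < b"
  shows "tg (t, {a..b}) = (b - a) * Max ((\<lambda>\<sigma>. \<bar>r_word \<sigma> / (b - a)\<bar>) ` words_meeting t {a<..<b})"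
proof -
  have "(\<exists>c. (\<lambda>x. R * x + c) \<in> \<V> (t, {a..b})) \<longleftrightarrow>
      (\<exists>\<sigma>\<in>words_meeting t {a<..<b}. R = r_word \<sigma> / (b - a))" for R
  proof
    assume "\<exists>c. (\<lambda>x. R * x + c) \<in> \<V> (t, {a..b})"
    then obtain c \<sigma> where \<sigma>: "\<sigma> \<in> words_meeting t {a<..<b}"
      and "(\<lambda>x. R * x + c) = (\<lambda>x. (S_word \<sigma> x - a) / (b - a))"
      unfolding \<V>_eq[OF assms] by blast
    then have eq: "R * x + c = (S_word \<sigma> x - a) / (b - a)" for x by meson
    \<comment> \<open>The slope of an affine function is its increment from 0 to 1, so the function
      determines \<open>R\<close>.\<close>
    have "R = (S_word \<sigma> 1 - a) / (b - a) - (S_word \<sigma> 0 - a) / (b - a)"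
      using eq[of 0] eq[of 1] by simp
    also have "\<dots> = r_word \<sigma> / (b - a)"
      using S_word_diff[of \<sigma> 1 0] by (simp flip: diff_divide_distrib)
    finally show "\<exists>\<sigma>\<in>words_meeting t {a<..<b}. R = r_word \<sigma> / (b - a)" using \<sigma> by blast
  next
    assume "\<exists>\<sigma>\<in>words_meeting t {a<..<b}. R = r_word \<sigma> / (b - a)"
    then obtain \<sigma> where \<sigma>: "\<sigma> \<in> words_meeting t {a<..<b}" "R = r_word \<sigma> / (b - a)" by blast
    have "(\<lambda>x. R * x + (S_word \<sigma> 0 - a) / (b - a)) = (\<lambda>x. (S_word \<sigma> x - a) / (b - a))"
    proof
      fix x
      show "R * x + (S_word \<sigma> 0 - a) / (b - a) = (S_word \<sigma> x - a) / (b - a)"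
        by (subst (2) S_word_affine) (simp add: \<sigma>(2) add_divide_distrib diff_divide_distrib)
    qed
    then show "\<exists>c. (\<lambda>x. R * x + c) \<in> \<V> (t, {a..b})"
      unfolding \<V>_eq[OF assms]
      by (intro exI[of _ "(S_word \<sigma> 0 - a) / (b - a)"] image_eqI[OF _ \<sigma>(1)])
  qed
  then have "{R. \<exists>c. (\<lambda>x. R * x + c) \<in> \<V> (t, {a..b})} =
      (\<lambda>\<sigma>. r_word \<sigma> / (b - a)) ` words_meeting t {a<..<b}"
    by blast
  moreover have "{\<bar>R\<bar> |R c. (\<lambda>x. R * x + c) \<in> \<V> (t, {a..b})} =
      abs ` {R. \<exists>c. (\<lambda>x. R * x + c) \<in> \<V> (t, {a..b})}"
    by blast
  ultimately have "{\<bar>R\<bar> |R c. (\<lambda>x. R * x + c) \<in> \<V> (t, {a..b})} =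
      (\<lambda>\<sigma>. \<bar>r_word \<sigma> / (b - a)\<bar>) ` words_meeting t {a<..<b}"
    by (simp add: image_image)
  then show ?thesis using assms by (simp add: tg.simps)
qed

lemma net_intervalI:
  "\<lbrakk>0 < t; a \<in> endpoints t; b \<in> endpoints t; a < b; endpoints t \<inter> {a<..<b} = {};
    {a<..<b} \<inter> K \<noteq> {}\<rbrakk> \<Longrightarrow> (t, {a..b}) \<in> net_intervals"
  unfolding net_intervals_def by blast

lemma net_intervalE:
  assumes "N \<in> net_intervals"
  obtains t a b where "N = (t, {a..b})" "0 < t" "a \<in> endpoints t" "b \<in> endpoints t" "a < b"
    "endpoints t \<inter> {a<..<b} = {}" "{a<..<b} \<inter> K \<noteq> {}"
  using assms unfolding net_intervals_def by blast

lemma net_intervalD: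
  assumes "(t, {a..b}) \<in> net_intervals"
  shows "0 < t" "a \<in> endpoints t" "b \<in> endpoints t" "a < b"
    "endpoints t \<inter> {a<..<b} = {}" "{a<..<b} \<inter> K \<noteq> {}"
proof -
  obtain a' b' where *: "{a..b} = {a'..b'}" "0 < t" "a' \<in> endpoints t" "b' \<in> endpoints t" "a' < b'"
    "endpoints t \<inter> {a'<..<b'} = {}" "{a'<..<b'} \<inter> K \<noteq> {}"
    using assms unfolding net_intervals_def by blast
  then have "a = a'" "b = b'" by (auto simp: Icc_eq_Icc)
  with * show "0 < t" "a \<in> endpoints t" "b \<in> endpoints t" "a < b"
    "endpoints t \<inter> {a<..<b} = {}" "{a<..<b} \<inter> K \<noteq> {}" by auto
qed

lemma finite_endpoints: "0 < t \<Longrightarrow> finite (endpoints t)"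
  by (simp add: endpoints_def finite_\<Lambda>)

lemma finite_net_intervals:
  assumes "0 < t" shows "finite {N \<in> net_intervals. fst N = t}"
proof (rule finite_subset)
  show "{N \<in> net_intervals. fst N = t} \<subseteq> (\<lambda>(a, b). (t, {a..b})) ` (endpoints t \<times> endpoints t)"
    by (force elim: net_intervalE)
qed (use finite_endpoints[OF assms] in auto)

text \<open>An endpoint is \<open>S_word \<pi> y\<close> with \<open>y\<close> in
  \<open>{0, 1}\<close>, hence in \<open>K\<close>. Some extension of \<open>\<pi>\<close> in the
  finer generation reaches it from a point \<open>z\<close> of \<open>K\<close>, and
  \<open>S_word_extreme\<close> forces \<open>z\<close> to be 0 or 1 again.\<close>

lemma endpoints_antimono:
  assumes "0 < s" "s \<le> t" shows "endpoints t \<subseteq> endpoints s"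
proof
  fix h assume "h \<in> endpoints t"
  then obtain \<pi> y where \<pi>: "\<pi> \<in> \<Lambda> t" "y \<in> {0, 1}" "h = S_word \<pi> y" by (auto simp: endpoints_def)
  then have "y \<in> K" using zero_in_K one_in_K by auto
  then obtain \<eta> z where \<eta>: "\<eta> \<in> lists I" "\<pi> @ \<eta> \<in> \<Lambda> s" "z \<in> K" "y = S_word \<eta> z"
    using extend_to_\<Lambda>[OF \<pi>(1) assms] by blast
  then have "z \<in> {0, 1}" using S_word_extreme[OF \<eta>(1)] \<pi>(2) K_subset by blast
  moreover have "h = S_word (\<pi> @ \<eta>) z" using \<pi> \<eta> by (simp add: S_word_append)
  ultimately show "h \<in> endpoints s" using \<eta>(2) by (auto simp: endpoints_def)
qed

lemma net_interval_around:
  assumes "0 < t" "y \<in> K" "y \<notin> endpoints t"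
  obtains a b where "(t, {a..b}) \<in> net_intervals" "a < y" "y < b"
proof -
  let ?P = "endpoints t"
  have fin: "finite ?P" by (rule finite_endpoints[OF assms(1)])
  obtain \<sigma> z where \<sigma>: "\<sigma> \<in> \<Lambda> t" "z \<in> K" "y = S_word \<sigma> z" using K_cover_\<Lambda>[OF assms(2,1)] by blast
  have z: "z \<in> {0..1}" using \<sigma> K_subset by auto
  have P: "S_word \<sigma> 0 \<in> ?P" "S_word \<sigma> 1 \<in> ?P" using \<sigma> by (auto simp: endpoints_def)
  have L: "{h \<in> ?P. h \<le> y} \<noteq> {}" and R: "{h \<in> ?P. y \<le> h} \<noteq> {}"
    using S_word_between[OF z, of \<sigma>] P \<sigma>(3) by (auto simp: min_def max_def split: if_splits)
  define a where "a = Max {h \<in> ?P. h \<le> y}"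
  define b where "b = Min {h \<in> ?P. y \<le> h}"
  have a: "a \<in> ?P" "a \<le> y" using Max_in[OF _ L] fin by (auto simp: a_def)
  have b: "b \<in> ?P" "y \<le> b" using Min_in[OF _ R] fin by (auto simp: b_def)
  have ab: "a < y" "y < b" using a b assms(3) by (auto simp: less_eq_real_def)
  have gap: "?P \<inter> {a<..<b} = {}"
  proof (rule ccontr)
    assume "?P \<inter> {a<..<b} \<noteq> {}"
    then obtain h where h: "h \<in> ?P" "a < h" "h < b" by auto
    have "h \<le> y \<Longrightarrow> h \<le> a" using fin h by (auto simp: a_def)
    moreover have "y \<le> h \<Longrightarrow> b \<le> h" using fin h by (auto simp: b_def)
    ultimately show False using h by linarith
  qed
  have "y \<in> {a<..<b} \<inter> K" using ab assms by simp
  then have "(t, {a..b}) \<in> net_intervals"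
    using a b ab gap assms(1) by (intro net_intervalI) auto
  then show ?thesis using ab by (rule that)
qed

text \<open>Because \<open>x\<close> may itself be an endpoint, the interval is built around a point
  \<open>y\<close> of \<open>K\<close> closer to \<open>x\<close> than every other endpoint; neither
  end of that interval can then separate \<open>y\<close> from \<open>x\<close>.\<close>

lemma net_interval_containing:
  assumes "0 < t" "x \<in> K"
  obtains a b where "(t, {a..b}) \<in> net_intervals" "a \<le> x" "x \<le> b"
proof -
  let ?P = "endpoints t"
  obtain e where e: "0 < e" "\<And>h. h \<in> ?P \<Longrightarrow> h \<noteq> x \<Longrightarrow> e \<le> dist x h"
    using finite_set_avoid[OF finite_endpoints[OF assms(1)], of x] by blast
  obtain y where y: "y \<in> K" "y \<noteq> x" "\<bar>y - x\<bar> < e" using K_perfect[OF assms(2) e(1)] .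
  then have "y \<notin> ?P" using e(2)[of y] by (auto simp: dist_real_def)
  then obtain a b where ab: "(t, {a..b}) \<in> net_intervals" "a < y" "y < b"
    using net_interval_around[OF assms(1) y(1)] by blast
  have "a \<le> x" "x \<le> b"
    using e(2)[of a] e(2)[of b] net_intervalD[OF ab(1)] ab y by (auto simp: dist_real_def)
  with ab show ?thesis by (intro that)
qed

text \<open>The image of \<open>K\<close> has a point in the gap, while
  \<open>S_word \<sigma> 0\<close> and \<open>S_word \<sigma> 1\<close>, the ends of its hull, are
  endpoints of generation \<open>t\<close> and stay outside the gap. So the hull spans the
  interval.\<close>

lemma net_interval_subset_image:
  assumes N: "(t, {a..b}) \<in> net_intervals" and \<sigma>: "\<sigma> \<in> words_meeting t {a<..<b}"
  shows "min (S_word \<sigma> 0) (S_word \<sigma> 1) \<le> a" "b \<le> max (S_word \<sigma> 0) (S_word \<sigma> 1)"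
    and "b - a \<le> \<bar>r_word \<sigma>\<bar>"
proof -
  obtain z where z: "z \<in> K" "a < S_word \<sigma> z" "S_word \<sigma> z < b" "\<sigma> \<in> \<Lambda> t"
    using \<sigma> by (auto simp: words_meeting_def)
  have "S_word \<sigma> 0 \<in> endpoints t" "S_word \<sigma> 1 \<in> endpoints t" using z by (auto simp: endpoints_def)
  then have "S_word \<sigma> 0 \<notin> {a<..<b}" "S_word \<sigma> 1 \<notin> {a<..<b}" using net_intervalD[OF N] by auto
  then show *: "min (S_word \<sigma> 0) (S_word \<sigma> 1) \<le> a" "b \<le> max (S_word \<sigma> 0) (S_word \<sigma> 1)"
    using S_word_between[of z \<sigma>] z K_subset by (auto simp: min_def max_def split: if_splits)
  show "b - a \<le> \<bar>r_word \<sigma>\<bar>" using * S_word_diff[of \<sigma> 1 0] by (auto simp: min_def max_def split: if_splits)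
qed

lemma words_meeting_net_interval:
  "(t, {a..b}) \<in> net_intervals \<Longrightarrow> words_meeting t {a<..<b} \<noteq> {}"
  using words_meeting_nonempty net_intervalD by (metis inf_commute)

lemma net_interval_length:
  assumes "(t, {a..b}) \<in> net_intervals" shows "b - a < t"
proof -
  obtain \<sigma> where \<sigma>: "\<sigma> \<in> words_meeting t {a<..<b}" using words_meeting_net_interval[OF assms] by blast
  then have "\<bar>r_word \<sigma>\<bar> < t" by (auto simp: words_meeting_def \<Lambda>_def)
  then show ?thesis using net_interval_subset_image(3)[OF assms \<sigma>] by simp
qed

section \<open>Transition generations, children and descendants\<close>

text \<open>The diameter factor in \<open>tg\<close> cancels against the normalisation by
  \<open>b - a\<close>, which leaves a maximum of ratios over a finite nonempty set of
  words.\<close>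

lemma tg_attained:
  assumes "(t, {a..b}) \<in> net_intervals"
  shows "\<exists>\<sigma>\<in>words_meeting t {a<..<b}. tg (t, {a..b}) = \<bar>r_word \<sigma>\<bar> \<and>
    (\<forall>\<tau>\<in>words_meeting t {a<..<b}. \<bar>r_word \<tau>\<bar> \<le> \<bar>r_word \<sigma>\<bar>)"
proof -
  let ?W = "words_meeting t {a<..<b}"
  have ab: "a < b" and t: "0 < t" using net_intervalD(1,4)[OF assms] by blast+
  have W: "finite ?W" "?W \<noteq> {}"
    using finite_words_meeting[OF t] words_meeting_net_interval[OF assms] by blast+
  define M where "M = Max ((\<lambda>\<sigma>. \<bar>r_word \<sigma> / (b - a)\<bar>) ` ?W)"
  have "M \<in> (\<lambda>\<sigma>. \<bar>r_word \<sigma> / (b - a)\<bar>) ` ?W"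
    unfolding M_def using W by (intro Max_in finite_imageI) blast+
  then obtain \<sigma> where \<sigma>: "\<sigma> \<in> ?W" "M = \<bar>r_word \<sigma> / (b - a)\<bar>" by blast
  have "tg (t, {a..b}) = (b - a) * M" unfolding M_def by (rule tg_eq[OF ab])
  then have tg: "tg (t, {a..b}) = \<bar>r_word \<sigma>\<bar>" using ab \<sigma>(2) by simp
  have "\<bar>r_word \<tau>\<bar> \<le> \<bar>r_word \<sigma>\<bar>" if \<tau>: "\<tau> \<in> ?W" for \<tau>
  proof -
    have "\<bar>r_word \<tau> / (b - a)\<bar> \<le> M" unfolding M_def using W(1) \<tau> by (intro Max_ge finite_imageI imageI)
    then show ?thesis unfolding \<sigma>(2) using ab by (simp add: divide_le_cancel)
  qed
  with \<sigma>(1) tg show ?thesis by blast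
qed

lemma tg_bounds:
  assumes "N \<in> net_intervals"
  shows "0 < tg N" "tg N < fst N" "\<exists>\<sigma>\<in>lists I. tg N = \<bar>r_word \<sigma>\<bar>"
proof -
  obtain t a b where N: "N = (t, {a..b})" using assms by (elim net_intervalE)
  obtain \<sigma> where \<sigma>: "\<sigma> \<in> words_meeting t {a<..<b}" "tg (t, {a..b}) = \<bar>r_word \<sigma>\<bar>"
    using tg_attained assms N by blast
  then have "\<sigma> \<in> lists I" "\<bar>r_word \<sigma>\<bar> < t" by (auto simp: words_meeting_def \<Lambda>_def)
  with \<sigma> N r_word_pos[of \<sigma>] show "0 < tg N" "tg N < fst N" "\<exists>\<sigma>\<in>lists I. tg N = \<bar>r_word \<sigma>\<bar>"
    by auto
qed

text \<open>As long as \<open>s\<close> exceeds \<open>tg\<close>, every word meeting the interior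
  has ratio below \<open>s\<close> and is not subdivided, so the gap and the neighbours stay those
  of generation \<open>t\<close>.\<close>

lemma net_interval_persists:
  assumes N: "(t, {a..b}) \<in> net_intervals" and s: "tg (t, {a..b}) < s" "s \<le> t"
  shows "(s, {a..b}) \<in> net_intervals" "\<V> (s, {a..b}) = \<V> (t, {a..b})"
proof -
  note ND = net_intervalD[OF N]
  have s0: "0 < s" using tg_bounds(1)[OF N] s by simp
  have less_s: "\<bar>r_word \<tau>\<bar> < s" if "\<tau> \<in> words_meeting t {a<..<b}" for \<tau>
    using tg_attained[OF N] s(1) that by (metis order_le_less_trans)
  have "words_meeting s {a<..<b} = words_meeting t {a<..<b}"
  proof
    show "words_meeting t {a<..<b} \<subseteq> words_meeting s {a<..<b}"
    proof
      fix \<tau> assume \<tau>: "\<tau> \<in> words_meeting t {a<..<b}"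
      then show "\<tau> \<in> words_meeting s {a<..<b}"
        using less_s[OF \<tau>] s(2) by (auto simp: words_meeting_def \<Lambda>_def)
    qed
    \<comment> \<open>A word of generation \<open>s\<close> has a prefix of generation
      \<open>t\<close> that meets the same interior. This prefix belongs to
      \<open>\<Lambda> s\<close> too, so prefix-freeness makes it the whole word.\<close>
    show "words_meeting s {a<..<b} \<subseteq> words_meeting t {a<..<b}"
    proof
      fix \<tau> assume \<tau>: "\<tau> \<in> words_meeting s {a<..<b}"
      then have "\<tau> \<in> lists I" "\<bar>r_word \<tau>\<bar> < t" using s(2) by (auto simp: words_meeting_def \<Lambda>_def)
      then obtain \<pi> \<eta> where \<pi>: "\<tau> = \<pi> @ \<eta>" "\<pi> \<in> \<Lambda> t" "\<eta> \<in> lists I" using prefix_in_\<Lambda> by blast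
      then have "\<pi> \<in> words_meeting t {a<..<b}"
        using \<tau> by (auto simp: words_meeting_def S_word_append intro: S_word_K)
      then have "\<pi> \<in> \<Lambda> s" using less_s[of \<pi>] \<pi>(2) s(2) by (auto simp: \<Lambda>_def)
      then have "\<eta> = []" using \<Lambda>_prefix_free \<tau> \<pi>(1) by (auto simp: words_meeting_def)
      with \<open>\<pi> \<in> words_meeting t {a<..<b}\<close> \<pi>(1) show "\<tau> \<in> words_meeting t {a<..<b}" by simp
    qed
  qed
  note eq = this
  then show "\<V> (s, {a..b}) = \<V> (t, {a..b})" using ND by (simp only: \<V>_eq)
  show "(s, {a..b}) \<in> net_intervals"
  proof (rule net_intervalI)
    show "endpoints s \<inter> {a<..<b} = {}"
    proof (rule ccontr)
      assume "endpoints s \<inter> {a<..<b} \<noteq> {}"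
      then obtain \<sigma> h where h: "\<sigma> \<in> \<Lambda> s" "h \<in> {S_word \<sigma> 0, S_word \<sigma> 1}" "h \<in> {a<..<b}"
        unfolding endpoints_def by blast
      then have "\<sigma> \<in> words_meeting s {a<..<b}"
        using zero_in_K one_in_K by (auto simp: words_meeting_def)
      then have "\<sigma> \<in> \<Lambda> t" using eq by (auto simp: words_meeting_def)
      then have "h \<in> endpoints t" using h by (auto simp: endpoints_def)
      with h ND show False by blast
    qed
  qed (use ND s0 endpoints_antimono[OF s0 s(2)] in auto)
qed

text \<open>\<open>a\<close> and \<open>b\<close> remain endpoints in the finer generation, so they
  cannot lie in the gap from \<open>u\<close> to \<open>v\<close>.\<close>

lemma net_interval_nested:
  assumes "(t, {a..b}) \<in> net_intervals" "(s, {u..v}) \<in> net_intervals" "s \<le> t"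
    and y: "y \<in> {a<..<b}" "y \<in> {u<..<v}"
  shows "a \<le> u" "v \<le> b"
proof -
  have "a \<in> endpoints s" "b \<in> endpoints s"
    using net_intervalD[OF assms(1)] endpoints_antimono[of s t] net_intervalD[OF assms(2)] assms(3) by auto
  then have "a \<notin> {u<..<v}" "b \<notin> {u<..<v}" using net_intervalD[OF assms(2)] by auto
  with y show "a \<le> u" "v \<le> b" by auto
qed

lemma \<Lambda>_large: "1 < t \<Longrightarrow> \<Lambda> t = {[]}"
proof -
  assume t: "1 < t"
  have "\<sigma> = []" if "\<sigma> \<in> \<Lambda> t" for \<sigma>
  proof (rule ccontr)
    assume "\<sigma> \<noteq> []"
    with that have "t \<le> \<bar>r_word (butlast \<sigma>)\<bar>" by (simp add: \<Lambda>_def)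
    moreover have "butlast \<sigma> \<in> lists I"
      using \<Lambda>_lists[OF that] by (auto simp: in_lists_conv_set dest: in_set_butlastD)
    ultimately show False using t r_word_le_one by fastforce
  qed
  then show ?thesis using t by (auto simp: \<Lambda>_def)
qed

lemma unit_net_interval:
  assumes "1 < t" shows "(t, {0..1}) \<in> net_intervals" "tg (t, {0..1}) = 1"
proof -
  obtain y where "y \<in> K" "y \<noteq> 0" "\<bar>y - 0\<bar> < 1" using K_perfect[OF zero_in_K, of 1] by auto
  then have "y \<in> {0<..<1} \<inter> K" using K_subset by auto
  moreover have "endpoints t = {0, 1}" by (simp add: endpoints_def \<Lambda>_large[OF assms])
  ultimately show N: "(t, {0..1}) \<in> net_intervals" using assms by (intro net_intervalI) auto
  obtain \<sigma> where "\<sigma> \<in> \<Lambda> t" "tg (t, {0..1}) = \<bar>r_word \<sigma>\<bar>"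
    using tg_attained[OF N] by (auto simp: words_meeting_def)
  then show "tg (t, {0..1}) = 1" using \<Lambda>_large[OF assms] by simp
qed

lemma childrenD:
  assumes "N' \<in> children N"
  shows "N' \<in> net_intervals" "fst N' = tg N" "snd N' \<subseteq> snd N"
  using assms by (auto simp: children_def)

lemma finite_children: "N \<in> net_intervals \<Longrightarrow> finite (children N)"
  by (rule finite_subset[OF _ finite_net_intervals[OF tg_bounds(1)]]) (auto simp: children_def)

lemma wf_transition_graph: "wf_digraph transition_graph"
  by unfold_locales (auto simp: transition_graph_def edge_def children_def)

lemma child_edge:
  assumes "N \<in> net_intervals" "N' \<in> children N"
  shows "edge N N' \<in> arcs transition_graph" "\<V> N \<rightarrow>\<^bsub>transition_graph\<^esub> \<V> N'"
proof -
  show *: "edge N N' \<in> arcs transition_graph" 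
    using assms by (simp add: transition_graph_def del: split_paired_Ex) blast
  have "tail transition_graph (edge N N') = \<V> N" "head transition_graph (edge N N') = \<V> N'"
    by (simp_all add: transition_graph_def edge_def)
  with * show "\<V> N \<rightarrow>\<^bsub>transition_graph\<^esub> \<V> N'" unfolding arcs_ends_conv by force
qed

lemma neighbour_set_vertex: "N \<in> net_intervals \<Longrightarrow> \<V> N \<in> verts transition_graph"
  by (simp add: transition_graph_def)

text \<open>Descend through the children around a fixed point \<open>y\<close> of \<open>K\<close>
  inside \<open>M\<close>. Their generations are word ratios, only finitely many of which are at
  least \<open>fst M\<close>; once the next one would be smaller, the current interval persists to
  generation \<open>fst M\<close> and coincides with \<open>M\<close>.\<close>

lemma descendant_reachable:
  assumes "N \<in> net_intervals" "M \<in> net_intervals" "fst M \<le> fst N" "snd M \<subseteq> snd N"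
  shows "\<V> N \<rightarrow>\<^sup>*\<^bsub>transition_graph\<^esub> \<V> M"
  using assms
proof (induction "card {\<sigma> \<in> lists I. fst M \<le> \<bar>r_word \<sigma>\<bar> \<and> \<bar>r_word \<sigma>\<bar> < fst N}"
    arbitrary: N rule: less_induct)
  case less
  interpret G: wf_digraph transition_graph by (rule wf_transition_graph)
  obtain t a b where N: "N = (t, {a..b})" using less.prems(1) by (elim net_intervalE)
  obtain s u v where M: "M = (s, {u..v})" using less.prems(2) by (elim net_intervalE)
  note ND = net_intervalD[OF less.prems(1)[unfolded N]]
  note MD = net_intervalD[OF less.prems(2)[unfolded M]]
  have st: "s \<le> t" and sub: "a \<le> u" "v \<le> b" using less.prems MD(4) by (auto simp: M N)
  obtain y where y: "y \<in> K" "u < y" "y < v" using MD(6) by auto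
  show ?case
  proof (cases "tg N < s")
    case True
    have p: "(s, {a..b}) \<in> net_intervals" "\<V> (s, {a..b}) = \<V> (t, {a..b})"
      using net_interval_persists[of t a b s] less.prems(1) True st by (auto simp: N)
    have "u \<le> a" "b \<le> v"
      using net_interval_nested[OF _ p(1), of s u v y] less.prems(2) y sub by (auto simp: M)
    then have "\<V> M = \<V> N" using p sub by (simp add: M N)
    then show ?thesis using neighbour_set_vertex[OF less.prems(1)] by simp
  next
    case False
    let ?t' = "tg N"
    have t': "0 < ?t'" "?t' < t" using tg_bounds[OF less.prems(1)] by (auto simp: N)
    \<comment> \<open>Endpoints only accumulate as the generation decreases, and \<open>y\<close>
      lies in the gap of \<open>M\<close>.\<close>
    have "y \<notin> endpoints ?t'" using endpoints_antimono[of s ?t'] MD y False by auto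
    then obtain c e where N': "(?t', {c..e}) \<in> net_intervals" and ce: "c < y" "y < e"
      using net_interval_around[OF t'(1) y(1)] by blast
    have "a \<le> c" "e \<le> b"
      using net_interval_nested[OF _ N', of t a b y] less.prems(1) y sub ce t' by (auto simp: N)
    then have child: "(?t', {c..e}) \<in> children N" using N' by (auto simp: children_def N)
    have "c \<le> u" "v \<le> e"
      using net_interval_nested[OF N', of s u v y] less.prems(2) False y ce by (auto simp: M)
    moreover have "card {\<sigma> \<in> lists I. fst M \<le> \<bar>r_word \<sigma>\<bar> \<and> \<bar>r_word \<sigma>\<bar> < fst (?t', {c..e})}
        < card {\<sigma> \<in> lists I. fst M \<le> \<bar>r_word \<sigma>\<bar> \<and> \<bar>r_word \<sigma>\<bar> < fst N}"
    proof (rule psubset_card_mono)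
      show "finite {\<sigma> \<in> lists I. fst M \<le> \<bar>r_word \<sigma>\<bar> \<and> \<bar>r_word \<sigma>\<bar> < fst N}"
        by (rule rev_finite_subset[OF finite_large_words[of s]]) (use MD M in auto)
      \<comment> \<open>The word whose ratio is the child's generation is counted for
        \<open>N\<close> but not for the child, whose upper bound is strict.\<close>
      obtain \<sigma> where "\<sigma> \<in> lists I" "?t' = \<bar>r_word \<sigma>\<bar>" using tg_bounds(3)[OF less.prems(1)] by blast
      then have "\<sigma> \<in> {\<sigma> \<in> lists I. fst M \<le> \<bar>r_word \<sigma>\<bar> \<and> \<bar>r_word \<sigma>\<bar> < fst N}"
        "\<sigma> \<notin> {\<sigma> \<in> lists I. fst M \<le> \<bar>r_word \<sigma>\<bar> \<and> \<bar>r_word \<sigma>\<bar> < fst (?t', {c..e})}"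
        using False t' by (auto simp: M N)
      then show "{\<sigma> \<in> lists I. fst M \<le> \<bar>r_word \<sigma>\<bar> \<and> \<bar>r_word \<sigma>\<bar> < fst (?t', {c..e})} \<subset>
          {\<sigma> \<in> lists I. fst M \<le> \<bar>r_word \<sigma>\<bar> \<and> \<bar>r_word \<sigma>\<bar> < fst N}"
        using t' N by force
    qed
    ultimately have "\<V> (?t', {c..e}) \<rightarrow>\<^sup>*\<^bsub>transition_graph\<^esub> \<V> M"
      using False N' less.prems(2) by (intro less.hyps) (auto simp: M)
    then show ?thesis using child_edge(2)[OF less.prems(1) child] G.adj_reachable_trans by blast
  qed
qed

text \<open>Transition generations along the chain strictly decrease and are word ratios, of which
  only finitely many are at least \<open>s\<close>.\<close>

lemma descending_generations:
  assumes N0: "N 0 \<in> net_intervals" and step: "\<And>n. N (Suc n) \<in> children (N n)" and s: "0 < s"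
  shows "\<exists>n. fst (N n) < s"
proof (rule ccontr)
  assume "\<not> ?thesis"
  then have large: "s \<le> fst (N n)" for n by (simp add: not_less)
  have net: "N n \<in> net_intervals" for n by (cases n) (use N0 childrenD(1)[OF step] in auto)
  \<comment> \<open>The shift by one skips \<open>fst (N 0)\<close>, which need not be the ratio of
    a word.\<close>
  define f where "f n = fst (N (Suc n))" for n
  have f: "f n = tg (N n)" for n using childrenD(2)[OF step] by (simp add: f_def)
  have "f (Suc n) < f n" for n using tg_bounds(2)[OF net[of "Suc n"]] by (simp add: f) (simp add: f_def flip: f)
  then have "strict_mono (\<lambda>n. - f n)" by (simp add: strict_mono_Suc_iff)
  then have "inj (\<lambda>n. - f n)" by (rule strict_mono_imp_inj_on)
  then have "inj f" by (auto simp: inj_def)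
  moreover have "range f \<subseteq> (\<lambda>\<sigma>. \<bar>r_word \<sigma>\<bar>) ` {\<sigma> \<in> lists I. s \<le> \<bar>r_word \<sigma>\<bar>}"
  proof (rule image_subsetI)
    fix n
    obtain \<sigma> where "\<sigma> \<in> lists I" "f n = \<bar>r_word \<sigma>\<bar>" using tg_bounds(3)[OF net[of n]] f by metis
    moreover have "s \<le> f n" using large by (simp add: f_def)
    ultimately show "f n \<in> (\<lambda>\<sigma>. \<bar>r_word \<sigma>\<bar>) ` {\<sigma> \<in> lists I. s \<le> \<bar>r_word \<sigma>\<bar>}" by auto
  qed
  then have "finite (range f)" using finite_large_words[OF s] finite_surj by blast
  ultimately show False by (simp add: finite_image_iff)
qed

subsection \<open>The essential class\<close>

text \<open>
  The vertices reachable from every vertex. As soon as there is one, they form the only essential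
  class, so no finiteness of the transition graph is needed.
\<close>

definition essential_verts :: "(real \<Rightarrow> real) set set" where
  "essential_verts = {v \<in> verts transition_graph. \<forall>u\<in>verts transition_graph. u \<rightarrow>\<^sup>*\<^bsub>transition_graph\<^esub> v}"

lemma essential_verts_closed:
  assumes "v \<in> essential_verts" "v \<rightarrow>\<^sup>*\<^bsub>transition_graph\<^esub> w" shows "w \<in> essential_verts"
proof -
  interpret G: wf_digraph transition_graph by (rule wf_transition_graph)
  show ?thesis using assms G.reachable_trans G.reachable_in_verts(2) unfolding essential_verts_def by blast
qed

lemma essential_verts_child:
  assumes "N \<in> net_intervals" "\<V> N \<in> essential_verts" "N' \<in> children N" shows "\<V> N' \<in> essential_verts"
proof -
  interpret G: wf_digraph transition_graph by (rule wf_transition_graph)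
  show ?thesis using essential_verts_closed[OF assms(2)] child_edge(2)[OF assms(1,3)] by blast
qed

text \<open>For uniqueness: another essential class is closed, so it contains
  \<open>essential_verts\<close>, which are reachable from its vertices; being strongly connected,
  it is in turn reachable from \<open>essential_verts\<close>, which is closed.\<close>

lemma G_ess_eq:
  assumes "essential_verts \<noteq> {}" shows "G_ess = induce_subgraph transition_graph essential_verts"
  unfolding G_ess_def
proof (rule the_equality)
  interpret G: wf_digraph transition_graph by (rule wf_transition_graph)
  have sub: "essential_verts \<subseteq> verts transition_graph" by (auto simp: essential_verts_def)
  have closed: "y \<in> essential_verts" if "x \<in> essential_verts" "x \<rightarrow>\<^bsub>transition_graph\<^esub> y" for x y
    using essential_verts_closed that by blast
  have "u \<rightarrow>\<^sup>*\<^bsub>induce_subgraph transition_graph essential_verts\<^esub> v" if "u \<in> essential_verts" "v \<in> essential_verts" for u v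
  proof (rule G.reachable_in_closed(2)[OF _ that(1) closed])
    show "u \<rightarrow>\<^sup>*\<^bsub>transition_graph\<^esub> v" using that sub by (auto simp: essential_verts_def)
  qed
  then have "strongly_connected (induce_subgraph transition_graph essential_verts)"
    using assms by (auto simp: strongly_connected_def)
  then show "essential_class (induce_subgraph transition_graph essential_verts)"
    unfolding essential_class_def using G.induced_induce[OF sub] essential_verts_closed by auto
  fix H assume H: "essential_class H"
  then have ind: "induced_subgraph H transition_graph" and sc: "strongly_connected H"
    and cl: "\<And>u v. u \<in> verts H \<Longrightarrow> u \<rightarrow>\<^sup>*\<^bsub>transition_graph\<^esub> v \<Longrightarrow> v \<in> verts H"
    by (auto simp: essential_class_def)
  have subg: "subgraph H transition_graph" using ind by (rule induced_imp_subgraph)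
  then have HG: "verts H \<subseteq> verts transition_graph" by (auto simp: subgraph_def)
  obtain h where h: "h \<in> verts H" using sc by (auto simp: strongly_connected_def)
  have "essential_verts \<subseteq> verts H" using cl[OF h] h HG by (auto simp: essential_verts_def)
  moreover have "verts H \<subseteq> essential_verts"
  proof
    fix w assume "w \<in> verts H"
    obtain v where v: "v \<in> essential_verts" using assms by auto
    with \<open>essential_verts \<subseteq> verts H\<close> \<open>w \<in> verts H\<close> sc have "v \<rightarrow>\<^sup>*\<^bsub>H\<^esub> w"
      by (auto simp: strongly_connected_def)
    then have "v \<rightarrow>\<^sup>*\<^bsub>transition_graph\<^esub> w" using G.reachable_mono subg by blast
    with v show "w \<in> essential_verts" by (rule essential_verts_closed)
  qed
  ultimately have "verts H = essential_verts" by auto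
  with ind show "H = induce_subgraph transition_graph essential_verts"
    by (intro pre_digraph.equality) (auto simp: induced_subgraph_def subgraph_def compatible_def)
qed

lemma arc_G_ess:
  assumes "essential_verts \<noteq> {}" "N \<in> net_intervals" "N' \<in> children N"
  shows "edge N N' \<in> arcs G_ess \<longleftrightarrow> \<V> N \<in> essential_verts \<and> \<V> N' \<in> essential_verts"
  using child_edge(1)[OF assms(2,3)]
  by (simp add: G_ess_eq[OF assms(1)]) (simp add: transition_graph_def edge_def)

subsection \<open>Balls attaining the supremum\<close>

definition max_ball :: "real \<Rightarrow> real \<Rightarrow> bool" where
  "max_ball x t \<longleftrightarrow> 0 < t \<and> enat (card (maps_meeting t (ball x t))) = separation_sup"

lemma card_maps_meeting_le: "0 < t \<Longrightarrow> enat (card (maps_meeting t (ball x t))) \<le> separation_sup"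
  unfolding separation_sup_def by (rule SUP_upper2[of "(x, t)"]) auto

lemma finite_maps_meeting: "0 < t \<Longrightarrow> finite (maps_meeting t E)"
  by (simp add: maps_meeting_eq finite_words_meeting)

lemma max_ballI:
  assumes "max_ball x t" "0 < s" "card (maps_meeting t (ball x t)) \<le> card (maps_meeting s (ball y s))"
  shows "max_ball y s"
  using assms card_maps_meeting_le[of s y] unfolding max_ball_def
  by (metis antisym enat_ord_simps(1))

text \<open>If all indices carried one map, \<open>K\<close> would be its own image under a strict
  contraction, although it contains 0 and 1 and lies in \<open>{0..1}\<close>.\<close>

lemma distinct_maps: "\<exists>i\<in>I. \<exists>j\<in>I. S i \<noteq> S j"
proof (rule ccontr)
  assume *: "\<not> ?thesis"
  obtain i where i: "i \<in> I" using I_nonempty by auto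
  have "K = (\<Union>j\<in>I. S j ` K)" unfolding S_def by (rule K_invariant)
  also have "\<dots> = (\<Union>j\<in>I. S i ` K)" using * i by (intro SUP_cong refl) metis
  also have "\<dots> = S i ` K" using i by auto
  finally have "0 \<in> S i ` K" "1 \<in> S i ` K" using zero_in_K one_in_K by blast+
  then obtain u v where uv: "u \<in> K" "v \<in> K" "0 = S i u" "1 = S i v" by blast
  then have "1 = r i * (v - u)" by (simp add: S_def algebra_simps)
  then have "1 = \<bar>r i\<bar> * \<bar>v - u\<bar>" by (metis abs_mult abs_one)
  moreover have "\<bar>v - u\<bar> \<le> 1" using subsetD[OF K_subset uv(1)] subsetD[OF K_subset uv(2)] by auto
  then have "\<bar>r i\<bar> * \<bar>v - u\<bar> \<le> \<bar>r i\<bar> * 1" by (intro mult_left_mono) auto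
  ultimately show False using ratio[OF i] by auto
qed

text \<open>One-letter words belong to \<open>\<Lambda> 1\<close>, and the ball about 1/2 contains
  \<open>{0..1}\<close>. The bound serves to exclude maximal balls of radius above 1, where at most
  the identity is counted.\<close>

lemma separation_sup_ge_2: "enat 2 \<le> separation_sup"
proof -
  obtain i j where ij: "i \<in> I" "j \<in> I" "S i \<noteq> S j" using distinct_maps by blast
  have "S k \<in> maps_meeting 1 (ball (1/2) 1)" if k: "k \<in> I" for k
  proof -
    have "[k] \<in> \<Lambda> 1" using ratio[OF k] k by (simp add: \<Lambda>_def)
    moreover have "S_word [k] 0 \<in> {0..1}" by (rule S_word_unit) (use k in auto)
    then have "S_word [k] 0 \<in> ball (1/2) 1" by (simp add: dist_real_def abs_if)
    ultimately have "S_word [k] \<in> maps_meeting 1 (ball (1/2) 1)"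
      using zero_in_K unfolding maps_meeting_def by blast
    then show ?thesis by simp
  qed
  then have "card {S i, S j} \<le> card (maps_meeting 1 (ball (1/2) 1))"
    using ij by (intro card_mono finite_maps_meeting) auto
  then have "enat 2 \<le> enat (card (maps_meeting 1 (ball (1/2) 1)))" using ij by simp
  also have "\<dots> \<le> separation_sup" by (rule card_maps_meeting_le) simp
  finally show ?thesis .
qed

lemma max_ball_card: "max_ball x t \<Longrightarrow> 2 \<le> card (maps_meeting t (ball x t))"
  using separation_sup_ge_2 unfolding max_ball_def by (metis enat_ord_simps(1))

lemma max_ball_le_one: assumes "max_ball x t" shows "t \<le> 1"
proof (rule ccontr)
  assume "\<not> t \<le> 1"
  then have "maps_meeting t (ball x t) \<subseteq> {id}" by (auto simp: maps_meeting_def \<Lambda>_large)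
  then have "card (maps_meeting t (ball x t)) \<le> card {id :: real \<Rightarrow> real}" by (intro card_mono) auto
  then show False using max_ball_card[OF assms] by simp
qed

lemma max_ball_meets_K: assumes "max_ball x t" shows "K \<inter> ball x t \<noteq> {}"
proof -
  have "maps_meeting t (ball x t) \<noteq> {}" using max_ball_card[OF assms] by auto
  then obtain \<sigma> where "\<sigma> \<in> \<Lambda> t" "S_word \<sigma> ` K \<inter> ball x t \<noteq> {}" by (auto simp: maps_meeting_def)
  then show ?thesis using S_word_K[OF \<Lambda>_lists] by blast
qed

lemma S_word_in_ball:
  assumes "\<tau> \<in> lists I"
  shows "S_word \<tau> y \<in> ball (S_word \<tau> x) (\<bar>r_word \<tau>\<bar> * t) \<longleftrightarrow> y \<in> ball x t"
  using r_word_pos[OF assms] by (simp add: dist_real_def S_word_diff abs_mult)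

lemma max_ball_image:
  assumes max: "max_ball x t" and \<tau>: "\<tau> \<in> lists I"
  shows "maps_meeting (\<bar>r_word \<tau>\<bar> * t) (ball (S_word \<tau> x) (\<bar>r_word \<tau>\<bar> * t)) =
      (\<lambda>f. S_word \<tau> \<circ> f) ` maps_meeting t (ball x t)"
    and "max_ball (S_word \<tau> x) (\<bar>r_word \<tau>\<bar> * t)"
proof -
  let ?s = "\<bar>r_word \<tau>\<bar> * t"
  let ?A = "(\<lambda>f. S_word \<tau> \<circ> f) ` maps_meeting t (ball x t)"
  let ?B = "maps_meeting ?s (ball (S_word \<tau> x) ?s)"
  have t: "0 < t" "t \<le> 1" using max max_ball_le_one by (auto simp: max_ball_def)
  then have s: "0 < ?s" using r_word_pos[OF \<tau>] by simp
  have sub: "?A \<subseteq> ?B"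
  proof
    fix g assume "g \<in> ?A"
    then obtain \<sigma> z where \<sigma>: "\<sigma> \<in> \<Lambda> t" "z \<in> K" "S_word \<sigma> z \<in> ball x t" "g = S_word (\<tau> @ \<sigma>)"
      unfolding maps_meeting_def S_word_append by blast
    then have "S_word (\<tau> @ \<sigma>) z \<in> ball (S_word \<tau> x) ?s"
      using S_word_in_ball[OF \<tau>] by (simp add: S_word_append)
    then show "g \<in> ?B"
      using append_in_\<Lambda>[OF \<sigma>(1) t(2) \<tau>] \<sigma> unfolding maps_meeting_def by blast
  qed
  have "inj_on (\<lambda>f. S_word \<tau> \<circ> f) (maps_meeting t (ball x t))"
    using inj_S_word[OF \<tau>] by (auto simp: inj_on_def fun_eq_iff dest: injD)
  then have card: "card ?A = card (maps_meeting t (ball x t))" by (rule card_image)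
  moreover have "card ?A \<le> card ?B" using sub finite_maps_meeting[OF s] by (intro card_mono) auto
  ultimately show m: "max_ball (S_word \<tau> x) ?s" using max_ballI[OF max s] by simp
  \<comment> \<open>Both balls attain the supremum, so the inclusion \<open>sub\<close> of finite
    sets of equal size is an equality.\<close>
  then have "card ?B = card ?A" using max card unfolding max_ball_def by (metis enat.inject)
  then show "?B = ?A" using card_subset_eq[OF finite_maps_meeting[OF s] sub] by simp
qed

text \<open>Each of the finitely many words meeting the open ball does so in a point that stays
  inside under a small shift of the centre. The count cannot drop, nor can it exceed the
  supremum.\<close>

lemma max_ball_shift:
  assumes "max_ball x t"
  shows "\<exists>e>0. \<forall>y. \<bar>y - x\<bar> < e \<longrightarrow> max_ball y t"
proof -
  let ?W = "words_meeting t (ball x t)"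
  have t: "0 < t" using assms by (simp add: max_ball_def)
  have "\<forall>\<^sub>F y in nhds x. S_word \<sigma> ` K \<inter> ball y t \<noteq> {}" if "\<sigma> \<in> ?W" for \<sigma>
  proof -
    have "S_word \<sigma> ` K \<inter> ball x t \<noteq> {}" using that unfolding words_meeting_def by blast
    then obtain z where "z \<in> S_word \<sigma> ` K" "z \<in> ball x t" by blast
    then have z: "z \<in> S_word \<sigma> ` K" "dist x z < t" by simp_all
    have "z \<in> S_word \<sigma> ` K \<inter> ball y t" if "dist y x < t - dist x z" for y
      using that z dist_triangle[of y z x] by simp
    then have "\<forall>y. dist y x < t - dist x z \<longrightarrow> S_word \<sigma> ` K \<inter> ball y t \<noteq> {}" by blast
    then show ?thesis unfolding eventually_nhds_metric
      using z(2) by (intro exI[of _ "t - dist x z"] conjI) simp_all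
  qed
  then have "\<forall>\<^sub>F y in nhds x. \<forall>\<sigma>\<in>?W. S_word \<sigma> ` K \<inter> ball y t \<noteq> {}"
    by (intro eventually_ball_finite finite_words_meeting t) blast
  then obtain e where e: "0 < e" "\<And>y \<sigma>. dist y x < e \<Longrightarrow> \<sigma> \<in> ?W \<Longrightarrow> S_word \<sigma> ` K \<inter> ball y t \<noteq> {}"
    unfolding eventually_nhds_metric by blast
  have "max_ball y t" if "\<bar>y - x\<bar> < e" for y
  proof -
    have "?W \<subseteq> words_meeting t (ball y t)"
      using e(2)[of y] that unfolding words_meeting_def dist_real_def by blast
    then have "maps_meeting t (ball x t) \<subseteq> maps_meeting t (ball y t)"
      unfolding maps_meeting_eq by (rule image_mono)
    then show ?thesis by (intro max_ballI[OF assms t] card_mono finite_maps_meeting t)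
  qed
  with e(1) show ?thesis by blast
qed

section \<open>Net intervals inside images of a maximal ball\<close>

text \<open>Carries the equality in \<open>max_ball_image\<close> to finer generations: the prefix
  of \<open>\<rho>\<close> of generation \<open>\<bar>r_word \<tau>\<bar> * t0\<close> has the same
  map as some \<open>\<tau> @ \<omega>\<close>, and the rest of \<open>\<rho>\<close> is appended to
  \<open>\<omega>\<close>.\<close>

lemma maps_meeting_in_max_ball:
  assumes max: "max_ball x0 t0" and t: "t \<le> t0" and \<tau>: "\<tau> \<in> lists I" and \<rho>: "\<rho> \<in> \<Lambda> (\<bar>r_word \<tau>\<bar> * t)"
    and z: "z \<in> K" "S_word \<rho> z \<in> S_word \<tau> ` ball x0 t0"
  obtains \<sigma> where "\<sigma> \<in> \<Lambda> t" "S_word \<rho> = S_word \<tau> \<circ> S_word \<sigma>"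
proof -
  let ?R = "\<bar>r_word \<tau>\<bar>"
  have R: "0 < ?R" using r_word_pos[OF \<tau>] .
  have t0: "t0 \<le> 1" using max by (rule max_ball_le_one)
  have "\<bar>r_word \<rho>\<bar> < ?R * t" "\<rho> \<in> lists I" using \<rho> by (auto simp: \<Lambda>_def)
  moreover have "?R * t \<le> ?R * t0" using t by (intro mult_left_mono) auto
  ultimately have "\<bar>r_word \<rho>\<bar> < ?R * t0" "\<rho> \<in> lists I" by simp_all
  then obtain \<pi> \<eta> where \<pi>: "\<rho> = \<pi> @ \<eta>" "\<pi> \<in> \<Lambda> (?R * t0)" "\<eta> \<in> lists I"
    using prefix_in_\<Lambda>[of \<rho> "?R * t0"] by auto
  obtain w where "S_word \<rho> z = S_word \<tau> w" "w \<in> ball x0 t0" using z(2) by blast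
  then have "S_word \<rho> z \<in> ball (S_word \<tau> x0) (?R * t0)" by (simp only: S_word_in_ball[OF \<tau>])
  moreover have "S_word \<rho> z = S_word \<pi> (S_word \<eta> z)" by (simp add: \<pi>(1) S_word_append)
  ultimately have "S_word \<pi> ` K \<inter> ball (S_word \<tau> x0) (?R * t0) \<noteq> {}"
    using S_word_K[OF \<pi>(3) z(1)] by (metis disjoint_iff imageI)
  then have "S_word \<pi> \<in> maps_meeting (?R * t0) (ball (S_word \<tau> x0) (?R * t0))"
    unfolding maps_meeting_def using \<pi>(2) by blast
  then have "S_word \<pi> \<in> (\<lambda>f. S_word \<tau> \<circ> f) ` maps_meeting t0 (ball x0 t0)"
    unfolding max_ball_image(1)[OF max \<tau>] .
  then obtain \<omega> where \<omega>: "\<omega> \<in> \<Lambda> t0" "S_word \<pi> = S_word (\<tau> @ \<omega>)"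
    unfolding maps_meeting_def S_word_append by blast
  \<comment> \<open>\<open>\<pi>\<close> and \<open>\<tau> @ \<omega>\<close> may be different
    words, but equal affine maps have equal slopes.\<close>
  have "r_word \<pi> = r_word (\<tau> @ \<omega>)"
    using S_word_diff[of \<pi> 1 0] S_word_diff[of "\<tau> @ \<omega>" 1 0] \<omega>(2) by simp
  then have r\<pi>: "\<bar>r_word \<pi>\<bar> = ?R * \<bar>r_word \<omega>\<bar>" by (simp add: abs_mult)
  have "?R * \<bar>r_word (\<omega> @ \<eta>)\<bar> = \<bar>r_word \<rho>\<bar>" using r\<pi> by (simp add: \<pi>(1) abs_mult)
  also have "\<dots> < ?R * t" by fact
  finally have small: "\<bar>r_word (\<omega> @ \<eta>)\<bar> < t" using R by simp
  \<comment> \<open>If \<open>\<eta>\<close> is empty, the parent is that of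
    \<open>\<omega>\<close>, with ratio at least \<open>t0\<close>; otherwise its ratio is that of
    the parent of \<open>\<rho>\<close> divided by the ratio of \<open>\<tau>\<close>, up to
    sign.\<close>
  have "t \<le> \<bar>r_word (butlast (\<omega> @ \<eta>))\<bar>"
  proof (cases "\<eta> = []")
    case True
    then show ?thesis using \<omega>(1) t \<Lambda>_nonempty_word[OF \<omega>(1) t0] by (auto simp: \<Lambda>_def)
  next
    case False
    then have "?R * t \<le> \<bar>r_word \<pi> * r_word (butlast \<eta>)\<bar>"
      using \<rho> by (simp add: \<Lambda>_def \<pi>(1) butlast_append)
    also have "\<dots> = ?R * \<bar>r_word \<omega> * r_word (butlast \<eta>)\<bar>" using r\<pi> by (simp add: abs_mult)
    finally show ?thesis using False R by (simp add: butlast_append)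
  qed
  with small have "\<omega> @ \<eta> \<in> \<Lambda> t" using \<omega>(1) \<pi>(3) by (auto simp: \<Lambda>_def)
  moreover have "S_word \<rho> = S_word \<tau> \<circ> S_word (\<omega> @ \<eta>)"
    using \<omega>(2) by (simp add: \<pi>(1) S_word_append o_assoc)
  ultimately show ?thesis by (rule that)
qed

text \<open>Every word meeting the image of the gap acts as a word of generation \<open>t\<close>
  followed by \<open>S_word \<tau>\<close>, so no new endpoint appears and the neighbours
  correspond. A positive ratio keeps the orientation, so normalisation cancels
  \<open>S_word \<tau>\<close>.\<close>

lemma max_ball_net_interval_image:
  assumes max: "max_ball x0 t0" and t: "t \<le> t0" and N: "(t, {a..b}) \<in> net_intervals"
    and sub: "{a<..<b} \<subseteq> ball x0 t0" and \<tau>: "\<tau> \<in> lists I" "0 < r_word \<tau>"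
  defines "M \<equiv> (r_word \<tau> * t, {S_word \<tau> a..S_word \<tau> b})"
  shows "M \<in> net_intervals" "\<V> M = \<V> (t, {a..b})"
proof -
  let ?f = "S_word \<tau>" and ?s = "r_word \<tau> * t"
  note ND = net_intervalD[OF N]
  have t1: "t \<le> 1" using t max_ball_le_one[OF max] by simp
  have diff: "?f x - ?f y = r_word \<tau> * (x - y)" for x y by (rule S_word_diff)
  have less: "?f x < ?f y \<longleftrightarrow> x < y" for x y
    using diff[of y x] \<tau>(2) by (metis diff_gt_0_iff_gt zero_less_mult_pos mult_pos_pos)
  have app: "\<tau> @ \<sigma> \<in> \<Lambda> ?s" if "\<sigma> \<in> \<Lambda> t" for \<sigma>
    using append_in_\<Lambda>[OF that t1 \<tau>(1)] \<tau>(2) by simp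
  have inv: "\<exists>\<sigma>\<in>\<Lambda> t. S_word \<rho> = ?f \<circ> S_word \<sigma>"
    if \<rho>: "\<rho> \<in> \<Lambda> ?s" "z \<in> K" "S_word \<rho> z \<in> {?f a<..<?f b}" for \<rho> z
  proof -
    define w where "w = a + (S_word \<rho> z - ?f a) / r_word \<tau>"
    have w: "?f w = S_word \<rho> z" using diff[of w a] \<tau>(2) by (simp add: w_def)
    then have "w \<in> {a<..<b}" using \<rho>(3) less by (metis greaterThanLessThan_iff)
    then have "S_word \<rho> z \<in> ?f ` ball x0 t0" using w sub by (metis imageI subsetD)
    moreover have "\<rho> \<in> \<Lambda> (\<bar>r_word \<tau>\<bar> * t)" using \<rho>(1) \<tau>(2) by simp
    ultimately show ?thesis using maps_meeting_in_max_ball[OF max t \<tau>(1) _ \<rho>(2)] by metis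
  qed
  have endp: "?f h \<in> endpoints ?s" if "h \<in> endpoints t" for h
  proof -
    obtain \<sigma> y where "\<sigma> \<in> \<Lambda> t" "y \<in> {0, 1}" "h = S_word \<sigma> y"
      using \<open>h \<in> endpoints t\<close> by (auto simp: endpoints_def)
    then have "\<tau> @ \<sigma> \<in> \<Lambda> ?s" "?f h = S_word (\<tau> @ \<sigma>) y" using app by (auto simp: S_word_append)
    with \<open>y \<in> {0, 1}\<close> show ?thesis by (auto simp: endpoints_def)
  qed
  show "M \<in> net_intervals"
    unfolding M_def
  proof (rule net_intervalI)
    show "endpoints ?s \<inter> {?f a<..<?f b} = {}"
    proof (rule ccontr)
      assume "endpoints ?s \<inter> {?f a<..<?f b} \<noteq> {}"
      then obtain h where h: "h \<in> endpoints ?s" "h \<in> {?f a<..<?f b}" by blast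
      then obtain \<rho> y where \<rho>: "\<rho> \<in> \<Lambda> ?s" "y \<in> {0, 1}" "h = S_word \<rho> y"
        unfolding endpoints_def by blast
      then have "y \<in> K" using zero_in_K one_in_K by auto
      then obtain \<sigma> where \<sigma>: "\<sigma> \<in> \<Lambda> t" "S_word \<rho> = ?f \<circ> S_word \<sigma>" using inv \<rho> h by blast
      then have "h = ?f (S_word \<sigma> y)" using \<rho>(3) by simp
      then have "S_word \<sigma> y \<in> {a<..<b}" using h(2) less by simp
      moreover have "S_word \<sigma> y \<in> endpoints t" using \<sigma>(1) \<rho>(2) by (auto simp: endpoints_def)
      ultimately show False using ND(5) by blast
    qed
    obtain y where "y \<in> K" "a < y" "y < b" using ND(6) by auto
    then have "?f y \<in> {?f a<..<?f b} \<inter> K" using less S_word_K[OF \<tau>(1)] by simp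
    then show "{?f a<..<?f b} \<inter> K \<noteq> {}" by blast
  qed (use ND \<tau> less endp in auto)
  have eq: "(\<lambda>x. (S_word \<rho> x - ?f a) / (?f b - ?f a)) = (\<lambda>x. (S_word \<sigma> x - a) / (b - a))"
    if "S_word \<rho> = ?f \<circ> S_word \<sigma>" for \<rho> \<sigma>
    using that \<tau>(2) by (simp add: diff)
  have "\<V> M \<subseteq> \<V> (t, {a..b})"
  proof
    fix g assume "g \<in> \<V> M"
    then obtain \<rho> where "\<rho> \<in> words_meeting ?s {?f a<..<?f b}"
      and g: "g = (\<lambda>x. (S_word \<rho> x - ?f a) / (?f b - ?f a))"
      using ND(4) less by (auto simp: M_def \<V>_eq)
    then obtain z where z: "\<rho> \<in> \<Lambda> ?s" "z \<in> K" "S_word \<rho> z \<in> {?f a<..<?f b}"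
      unfolding words_meeting_def by blast
    then obtain \<sigma> where \<sigma>: "\<sigma> \<in> \<Lambda> t" "S_word \<rho> = ?f \<circ> S_word \<sigma>" using inv by blast
    then have "S_word \<sigma> z \<in> {a<..<b}" using z(3) less by simp
    then have "\<sigma> \<in> words_meeting t {a<..<b}" using \<sigma>(1) z(2) unfolding words_meeting_def by blast
    then show "g \<in> \<V> (t, {a..b})" unfolding g eq[OF \<sigma>(2)] \<V>_eq[OF ND(4)] by blast
  qed
  moreover have "\<V> (t, {a..b}) \<subseteq> \<V> M"
  proof
    fix g assume "g \<in> \<V> (t, {a..b})"
    then obtain \<sigma> where "\<sigma> \<in> words_meeting t {a<..<b}"
      and g: "g = (\<lambda>x. (S_word \<sigma> x - a) / (b - a))"
      using ND(4) by (auto simp: \<V>_eq)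
    then obtain z where z: "\<sigma> \<in> \<Lambda> t" "z \<in> K" "S_word \<sigma> z \<in> {a<..<b}"
      unfolding words_meeting_def by blast
    then have "S_word (\<tau> @ \<sigma>) z \<in> {?f a<..<?f b}" using less by (simp add: S_word_append)
    then have "\<tau> @ \<sigma> \<in> words_meeting ?s {?f a<..<?f b}"
      using app[OF z(1)] z(2) unfolding words_meeting_def by blast
    then show "g \<in> \<V> M"
      unfolding g M_def \<V>_eq[OF less[THEN iffD2, OF ND(4)]] eq[OF S_word_append, symmetric] by blast
  qed
  ultimately show "\<V> M = \<V> (t, {a..b})" by blast
qed

text \<open>Squaring a word makes its ratio positive.\<close>

lemma positive_word_near:
  assumes "y \<in> K" "0 < e"
  obtains \<tau> where "\<tau> \<in> lists I" "0 < r_word \<tau>" "r_word \<tau> < e" "\<And>x. x \<in> {0..1} \<Longrightarrow> \<bar>S_word \<tau> x - y\<bar> < e"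
proof -
  obtain \<sigma> z where \<sigma>: "\<sigma> \<in> lists I" "z \<in> K" "y = S_word \<sigma> z" "\<bar>r_word \<sigma>\<bar> < e"
    using K_cover_small[OF assms] by blast
  have near: "\<bar>S_word \<sigma> x - y\<bar> < e" if "x \<in> {0..1}" for x
  proof -
    have "\<bar>S_word \<sigma> x - y\<bar> = \<bar>r_word \<sigma>\<bar> * \<bar>x - z\<bar>"
      using S_word_diff[of \<sigma> x z] \<sigma> by (simp add: abs_mult)
    also have "\<dots> \<le> \<bar>r_word \<sigma>\<bar> * 1"
      using that subsetD[OF K_subset \<sigma>(2)] by (intro mult_left_mono) auto
    finally show ?thesis using \<sigma> by simp
  qed
  show ?thesis
  proof (rule that[of "\<sigma> @ \<sigma>"])
    show "0 < r_word (\<sigma> @ \<sigma>)" using r_word_nonzero[OF \<sigma>(1)] by (auto simp: zero_less_mult_iff)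
    have "r_word (\<sigma> @ \<sigma>) \<le> \<bar>r_word \<sigma>\<bar> * \<bar>r_word \<sigma>\<bar>" by simp
    also have "\<dots> \<le> \<bar>r_word \<sigma>\<bar> * 1" using r_word_le_one[OF \<sigma>(1)] by (intro mult_left_mono) auto
    finally show "r_word (\<sigma> @ \<sigma>) < e" using \<sigma>(4) by simp
    show "\<bar>S_word (\<sigma> @ \<sigma>) x - y\<bar> < e" if "x \<in> {0..1}" for x
      using near[OF S_word_unit[OF \<sigma>(1) that]] by (simp add: S_word_append)
  qed (use \<sigma> in auto)
qed

lemma endpoints_unit: "endpoints t \<subseteq> {0..1}"
  using S_word_unit[OF \<Lambda>_lists] unfolding endpoints_def by fastforce

lemma max_ball_net_interval_essential_verts:
  assumes max: "max_ball x0 t0" and t: "t \<le> t0" and N: "(t, {a..b}) \<in> net_intervals"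
    and sub: "{a<..<b} \<subseteq> ball x0 t0"
  shows "\<V> (t, {a..b}) \<in> essential_verts"
proof -
  have "u \<rightarrow>\<^sup>*\<^bsub>transition_graph\<^esub> \<V> (t, {a..b})" if "u \<in> verts transition_graph" for u
  proof -
    have "u \<in> \<V> ` net_intervals" using that by (simp add: transition_graph_def)
    then obtain N' where N': "u = \<V> N'" "N' \<in> net_intervals" by blast
    obtain s c e where ce: "N' = (s, {c..e})" using N'(2) by (elim net_intervalE)
    note D = net_intervalD[OF N'(2)[unfolded ce]]
    obtain y where y: "y \<in> K" "c < y" "y < e" using D(6) by auto
    \<comment> \<open>The distances from \<open>y\<close> to both ends keep the copy inside
      \<open>N'\<close>; the bound \<open>s\<close> makes its generation small enough for
      \<open>descendant_reachable\<close>.\<close>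
    define \<delta> where "\<delta> = min s (min (y - c) (e - y))"
    have "0 < \<delta>" using y D(1) by (simp add: \<delta>_def)
    then obtain \<tau> where \<tau>: "\<tau> \<in> lists I" "0 < r_word \<tau>" "r_word \<tau> < \<delta>"
      "\<And>x. x \<in> {0..1} \<Longrightarrow> \<bar>S_word \<tau> x - y\<bar> < \<delta>"
      using positive_word_near[OF y(1)] by blast
    let ?M = "(r_word \<tau> * t, {S_word \<tau> a..S_word \<tau> b})"
    have M: "?M \<in> net_intervals" "\<V> ?M = \<V> (t, {a..b})"
      using max_ball_net_interval_image[OF max t N sub \<tau>(1,2)] by auto
    have "a \<in> {0..1}" "b \<in> {0..1}" using net_intervalD(2,3)[OF N] endpoints_unit by blast+
    then have "\<bar>S_word \<tau> a - y\<bar> < \<delta>" "\<bar>S_word \<tau> b - y\<bar> < \<delta>" using \<tau>(4) by blast+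
    then have "snd ?M \<subseteq> snd N'" unfolding ce \<delta>_def by auto
    moreover have "r_word \<tau> * t \<le> r_word \<tau> * 1"
      using t max_ball_le_one[OF max] \<tau>(2) by (intro mult_left_mono) auto
    then have "fst ?M \<le> fst N'" using \<tau>(3) unfolding ce \<delta>_def by simp
    ultimately have "\<V> N' \<rightarrow>\<^sup>*\<^bsub>transition_graph\<^esub> \<V> ?M"
      using descendant_reachable[OF N'(2) M(1)] by blast
    then show ?thesis using N'(1) M(2) by simp
  qed
  then show ?thesis using neighbour_set_vertex[OF N] by (simp add: essential_verts_def)
qed

lemma max_ball_generation:
  assumes max: "max_ball x0 t0"
  obtains t where "0 < t" "t \<le> t0"
    "\<And>a b. (t, {a..b}) \<in> net_intervals \<Longrightarrow> {a..b} \<inter> ball x0 t0 \<noteq> {} \<Longrightarrow> \<V> (t, {a..b}) \<in> essential_verts"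
proof -
  obtain e where e: "0 < e" "\<And>y. \<bar>y - x0\<bar> < e \<Longrightarrow> max_ball y t0"
    using max_ball_shift[OF max] by blast
  have t0: "0 < t0" using max by (simp add: max_ball_def)
  let ?t = "min e t0"
  show ?thesis
  proof (rule that[of ?t])
    fix a b assume N: "(?t, {a..b}) \<in> net_intervals" and meets: "{a..b} \<inter> ball x0 t0 \<noteq> {}"
    have len: "b - a < ?t" using net_interval_length[OF N] .
    obtain y where y: "a \<le> y" "y \<le> b" "\<bar>x0 - y\<bar> < t0" using meets by (auto simp: dist_real_def)
    \<comment> \<open>Shift the ball just far enough to cover an end that sticks out. Since the
      interval meets the original ball, the shift is less than its length, hence less than
      \<open>e\<close>; the other end fits because the length is also below
      \<open>t0\<close>.\<close>
    define c where "c = (if a < x0 - t0 then a + t0 else if x0 + t0 < b then b - t0 else x0)"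
    have c: "\<bar>c - x0\<bar> < e" "c - t0 \<le> a" "b \<le> c + t0"
      using len y e(1) t0 by (auto simp: c_def min_def abs_if split: if_splits)
    then have "{a<..<b} \<subseteq> ball c t0" by (auto simp: dist_real_def abs_if)
    then show "\<V> (?t, {a..b}) \<in> essential_verts"
      using max_ball_net_interval_essential_verts[OF e(2)[OF c(1)] _ N] by simp
  qed (use e t0 in auto)
qed

text \<open>An infinite set of extended naturals has supremum \<open>\<infinity>\<close>, so here
  the supremum is a maximum.\<close>

lemma exists_max_ball:
  assumes weak_separation
  obtains x t where "max_ball x t"
proof -
  let ?A = "(\<lambda>(x, t). enat (card (maps_meeting t (ball x t)))) ` (UNIV \<times> {0<..})"
  have sup: "separation_sup = Sup ?A" by (simp add: separation_sup_def)
  have ne: "?A \<noteq> {}" by auto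
  have fin: "finite ?A"
  proof (rule ccontr)
    assume "infinite ?A"
    then have "Sup ?A = \<infinity>" using ne by (simp add: Sup_enat_def)
    then show False using assms sup by (simp add: weak_separation_def)
  qed
  then have "Sup ?A = Max ?A" using ne by (simp add: Sup_enat_def)
  then have "separation_sup \<in> ?A" using sup Max_in[OF fin ne] by metis
  then obtain x t where "0 < t" "separation_sup = enat (card (maps_meeting t (ball x t)))" by auto
  then show ?thesis using that by (simp add: max_ball_def)
qed

subsection \<open>Interior essential points\<close>

lemma chain_net_interval:
  assumes "N 0 \<in> net_intervals" "\<And>n. N (Suc n) \<in> children (N n)"
  shows "N n \<in> net_intervals"
  by (cases n) (use assms(1) childrenD(1)[OF assms(2)] in auto)

lemma chain_essential_verts:
  assumes N: "N 0 \<in> net_intervals" "\<And>n. N (Suc n) \<in> children (N n)"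
    and "\<V> (N m) \<in> essential_verts" "m \<le> n"
  shows "\<V> (N n) \<in> essential_verts"
  using assms(4)
proof (induction n rule: dec_induct)
  case (step n)
  then show ?case using essential_verts_child[OF chain_net_interval[of N, OF N] _ N(2)] by blast
qed (rule assms(3))

lemma root_net_interval: "1 < fst M \<Longrightarrow> snd M = {0..1} \<Longrightarrow> M \<in> net_intervals"
  using unit_net_interval(1) by (metis prod.collapse)

text \<open>Children of essential net intervals are essential, so all late edges lie in
  \<open>G_ess\<close> as soon as one vertex of the chain is essential.\<close>

lemma symbolic_representation_chain:
  assumes "symbolic_representation x e" "essential_verts \<noteq> {}"
  shows "\<exists>N. 1 < fst (N 0) \<and> snd (N 0) = {0..1} \<and> (\<forall>n. N (Suc n) \<in> children (N n)) \<and>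
    (\<forall>n. x \<in> snd (N n)) \<and> (\<forall>n. N n \<in> net_intervals) \<and>
    ((\<exists>m. \<forall>k\<ge>m. e k \<in> arcs G_ess) \<longleftrightarrow> (\<exists>m. \<V> (N m) \<in> essential_verts))"
proof -
  obtain N where N: "1 < fst (N 0)" "snd (N 0) = {0..1}" "\<forall>n. N (Suc n) \<in> children (N n)"
    "(\<Inter>n. snd (N n)) = {x}" "\<forall>n. e n = edge (N n) (N (Suc n))"
    using assms(1) unfolding symbolic_representation_def by blast
  have ch: "N (Suc n) \<in> children (N n)" for n using N(3) by blast
  have N0: "N 0 \<in> net_intervals" using N(1,2) by (rule root_net_interval)
  have net: "N n \<in> net_intervals" for n by (rule chain_net_interval[of N, OF N0 ch])
  have "(\<exists>m. \<forall>k\<ge>m. e k \<in> arcs G_ess) \<longleftrightarrow> (\<exists>m. \<V> (N m) \<in> essential_verts)"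
  proof -
    have "e k \<in> arcs G_ess \<longleftrightarrow> \<V> (N k) \<in> essential_verts \<and> \<V> (N (Suc k)) \<in> essential_verts" for k
      using arc_G_ess[OF assms(2) net ch] N(5) by simp
    then show ?thesis using chain_essential_verts[of N, OF N0 ch] by (metis order_refl le_Suc_eq)
  qed
  moreover have "x \<in> snd (N n)" for n using N(4) by blast
  ultimately show ?thesis using N(1,2) ch net by blast
qed

lemma max_ball_essential_verts_nonempty: assumes "max_ball x0 t0" shows "essential_verts \<noteq> {}"
proof -
  obtain x where x: "x \<in> K" "x \<in> ball x0 t0" using max_ball_meets_K[OF assms] by blast
  obtain t where t: "0 < t"
    "\<And>a b. (t, {a..b}) \<in> net_intervals \<Longrightarrow> {a..b} \<inter> ball x0 t0 \<noteq> {} \<Longrightarrow> \<V> (t, {a..b}) \<in> essential_verts"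
    using max_ball_generation[OF assms] by metis
  obtain a b where "(t, {a..b}) \<in> net_intervals" "a \<le> x" "x \<le> b"
    using net_interval_containing[OF t(1) x(1)] .
  moreover from this have "x \<in> {a..b}" by simp
  ultimately have "\<V> (t, {a..b}) \<in> essential_verts" using t(2) x(2) by blast
  then show ?thesis by blast
qed

lemma max_ball_cover:
  assumes "max_ball x0 t0"
  shows "\<exists>F. finite F \<and> (\<forall>N\<in>F. essential N) \<and> K \<inter> ball x0 t0 \<subseteq> (\<Union>N\<in>F. snd N)"
proof -
  obtain t where t: "0 < t"
    "\<And>a b. (t, {a..b}) \<in> net_intervals \<Longrightarrow> {a..b} \<inter> ball x0 t0 \<noteq> {} \<Longrightarrow> \<V> (t, {a..b}) \<in> essential_verts"
    using max_ball_generation[OF assms] by metis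
  let ?F = "{N \<in> net_intervals. fst N = t \<and> snd N \<inter> ball x0 t0 \<noteq> {}}"
  have "finite ?F" by (rule finite_subset[OF _ finite_net_intervals[OF t(1)]]) auto
  moreover have "essential N" if "N \<in> ?F" for N
  proof -
    have "N \<in> net_intervals" "fst N = t" using that by auto
    then obtain a b where "N = (t, {a..b})" by (elim net_intervalE) simp
    then have "\<V> N \<in> essential_verts" "N \<in> net_intervals" using that t(2) by auto
    then show ?thesis
      unfolding essential_def G_ess_eq[OF max_ball_essential_verts_nonempty[OF assms]] by simp
  qed
  moreover have "x \<in> (\<Union>N\<in>?F. snd N)" if x: "x \<in> K" "x \<in> ball x0 t0" for x
  proof -
    obtain a b where ab: "(t, {a..b}) \<in> net_intervals" "a \<le> x" "x \<le> b"
      using net_interval_containing[OF t(1) x(1)] .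
    then have "x \<in> {a..b}" by simp
    with ab(1) x(2) have "(t, {a..b}) \<in> ?F" by auto
    with \<open>x \<in> {a..b}\<close> show ?thesis by force
  qed
  ultimately show ?thesis by (intro exI[of _ ?F]) blast
qed

text \<open>Whatever chain represents \<open>x\<close>, its intervals contain \<open>x\<close> and
  shrink, so one of generation at most \<open>t0\<close> has its interior inside the ball.\<close>

lemma max_ball_K_ess:
  assumes max: "max_ball x0 t0"
  shows "K \<inter> ball x0 t0 \<subseteq> K_ess"
proof
  fix x assume x: "x \<in> K \<inter> ball x0 t0"
  have t0: "0 < t0" using max by (simp add: max_ball_def)
  obtain e where e: "0 < e" "ball x e \<subseteq> ball x0 t0" using x openE[OF open_ball] by blast
  have "\<exists>m. \<forall>k\<ge>m. f k \<in> arcs G_ess" if rep: "symbolic_representation x f" for f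
  proof -
    obtain N where N: "\<And>n. N (Suc n) \<in> children (N n)" "\<And>n. x \<in> snd (N n)"
      "\<And>n. N n \<in> net_intervals" "(\<exists>m. \<forall>k\<ge>m. f k \<in> arcs G_ess) \<longleftrightarrow> (\<exists>m. \<V> (N m) \<in> essential_verts)"
      using symbolic_representation_chain[OF rep max_ball_essential_verts_nonempty[OF max]] by blast
    obtain n where n: "fst (N n) < min e t0"
      using descending_generations[of N "min e t0", OF N(3,1)] e(1) t0 by auto
    obtain t a b where ab: "N n = (t, {a..b})" using N(3)[of n] by (elim net_intervalE)
    have "x \<in> {a..b}" using N(2)[of n] by (simp add: ab)
    moreover have "b - a < t" using net_interval_length N(3)[of n] ab by metis
    ultimately have "{a<..<b} \<subseteq> ball x e" using n by (auto simp: ab dist_real_def abs_if)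
    then have "{a<..<b} \<subseteq> ball x0 t0" using e(2) by blast
    then have "\<V> (N n) \<in> essential_verts"
      using max_ball_net_interval_essential_verts[OF max, of t a b] n N(3)[of n] by (simp add: ab)
    then show ?thesis using N(4) by blast
  qed
  then show "x \<in> K_ess" using x by (simp add: K_ess_def)
qed

section \<open>The tree of inessential net intervals\<close>

definition inessential_child :: "((real \<times> real set) \<times> (real \<times> real set)) set" where
  "inessential_child = {(N, N'). N \<in> net_intervals \<and> N' \<in> children N \<and> \<V> N' \<notin> essential_verts}"

lemma finite_inessential_descendants:
  "finite {M. (N, M) \<in> inessential_child ^^ n}"
proof (induction n)
  case (Suc n)
  have "{M. (N, M) \<in> inessential_child ^^ Suc n} \<subseteq>
      (\<Union>L\<in>{L. (N, L) \<in> inessential_child ^^ n}. if L \<in> net_intervals then children L else {})"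
    by (auto simp: inessential_child_def)
  moreover have "finite \<dots>" using Suc.IH finite_children by (intro finite_UN_I) auto
  ultimately show ?case by (rule finite_subset)
qed simp

lemma inessential_descendant_subset:
  "(N, M) \<in> inessential_child ^^ n \<Longrightarrow> snd M \<subseteq> snd N"
proof (induction n arbitrary: M)
  case (Suc n)
  then obtain L where "(N, L) \<in> inessential_child ^^ n" "(L, M) \<in> inessential_child" by auto
  then show ?case using Suc.IH[of L] childrenD(3)[of M L] by (auto simp: inessential_child_def)
qed simp

lemma inessential_descendant_net:
  "(N, M) \<in> inessential_child ^^ n \<Longrightarrow> N \<in> net_intervals \<Longrightarrow> M \<in> net_intervals"
  by (cases n) (auto simp: inessential_child_def dest: childrenD(1))

text \<open>Asks for paths of every finite depth, not for an infinite branch: this makes the set of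
  such \<open>x\<close> an intersection over \<open>n\<close> of finite unions of intervals, whence
  closedness.\<close>

definition inessential_at :: "real \<Rightarrow> real \<times> real set \<Rightarrow> bool" where
  "inessential_at x N \<longleftrightarrow> (\<forall>n. \<exists>M. (N, M) \<in> inessential_child ^^ n \<and> x \<in> snd M)"

text \<open>Koenig's lemma: finitely many children, and descendants containing \<open>x\<close> pass to ancestors.\<close>

lemma inessential_at_child:
  assumes "inessential_at x N"
  shows "\<exists>N'. (N, N') \<in> inessential_child \<and> inessential_at x N'"
proof (rule ccontr)
  assume none: "\<not> ?thesis"
  let ?C = "{N'. (N, N') \<in> inessential_child}"
  have fin: "finite ?C" using finite_inessential_descendants[of N 1] by simp
  have "\<forall>N'\<in>?C. \<exists>n. \<forall>M. (N', M) \<in> inessential_child ^^ n \<longrightarrow> x \<notin> snd M"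
    using none unfolding inessential_at_def by blast
  then obtain f where f: "\<forall>N'\<in>?C. \<forall>M. (N', M) \<in> inessential_child ^^ f N' \<longrightarrow> x \<notin> snd M"
    by (metis (no_types))
  \<comment> \<open>The sum dominates every \<open>f N'\<close>, so a descendant at depth
    \<open>Suc m\<close> passes, below whichever child, through a depth at which \<open>x\<close> is
    excluded.\<close>
  define m where "m = sum f ?C"
  obtain M where M: "(N, M) \<in> inessential_child ^^ Suc m" "x \<in> snd M"
    using assms unfolding inessential_at_def by blast
  obtain N' where N': "(N, N') \<in> inessential_child" "(N', M) \<in> inessential_child ^^ m"
    using relpow_Suc_D2[OF M(1)] by blast
  have "f N' \<le> m" unfolding m_def using N'(1) fin by (intro member_le_sum) auto
  then obtain k where "m = f N' + k" using le_Suc_ex by blast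
  then obtain L where L: "(N', L) \<in> inessential_child ^^ f N'" "(L, M) \<in> inessential_child ^^ k"
    using N'(2) by (auto simp: relpow_add)
  then have "x \<in> snd L" using inessential_descendant_subset M(2) by blast
  then show False using f N'(1) L(1) by blast
qed

text \<open>Generations bound lengths and become arbitrarily small, and each interval contains
  points of the closed set \<open>K\<close>.\<close>

lemma shrinking_net_intervals:
  assumes N: "N 0 \<in> net_intervals" "\<And>n. N (Suc n) \<in> children (N n)" and x: "\<And>n. x \<in> snd (N n)"
  shows "x \<in> K" "(\<Inter>n. snd (N n)) = {x}"
proof -
  have small: "\<exists>n. (\<exists>y\<in>K. \<bar>y - x\<bar> < e) \<and> (\<forall>y\<in>snd (N n). \<bar>y - x\<bar> < e)" if "0 < e" for e
  proof -
    obtain n where n: "fst (N n) < e" using descending_generations[of N, OF N \<open>0 < e\<close>] by blast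
    have net: "N n \<in> net_intervals" by (rule chain_net_interval[of N, OF N])
    then obtain t a b where ab: "N n = (t, {a..b})" by (elim net_intervalE)
    have len: "b - a < t" using net_interval_length net ab by metis
    obtain z where z: "z \<in> K" "a < z" "z < b" using net_intervalD(6)[OF net[unfolded ab]] by auto
    have "x \<in> {a..b}" using x[of n] by (simp add: ab)
    then have near: "\<bar>y - x\<bar> < e" if "y \<in> {a..b}" for y using that len n by (auto simp: ab)
    then have "\<forall>y\<in>snd (N n). \<bar>y - x\<bar> < e" "\<bar>z - x\<bar> < e" using z by (auto simp: ab)
    then show ?thesis using z(1) by blast
  qed
  then show "x \<in> K"
    unfolding closed_approachable[OF K_closed, symmetric] dist_real_def by blast
  have "y = x" if "\<And>n. y \<in> snd (N n)" for y
  proof (rule ccontr)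
    assume "y \<noteq> x"
    then have "0 < \<bar>y - x\<bar>" by simp
    then show False using small that by blast
  qed
  then show "(\<Inter>n. snd (N n)) = {x}" using x by blast
qed

text \<open>The root may carry any generation above 1, but its transition generation is always
  1.\<close>

lemma children_root:
  "1 < fst M \<Longrightarrow> snd M = {0..1} \<Longrightarrow> children M = children (2, {0..1})"
  unfolding children_def using unit_net_interval(2)[of "fst M"] unit_net_interval(2)[of 2]
  by (metis prod.collapse snd_conv one_less_numeral_iff semiring_norm(76))

lemma K_diff_K_ess_eq:
  assumes "essential_verts \<noteq> {}"
  shows "K - K_ess = {x. inessential_at x (2, {0..1})}"
proof (intro equalityI subsetI)
  fix x assume x: "x \<in> K - K_ess"
  then obtain e where e: "symbolic_representation x e" "\<not> (\<exists>m. \<forall>k\<ge>m. e k \<in> arcs G_ess)"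
    unfolding K_ess_def by blast
  obtain N where N: "1 < fst (N 0)" "snd (N 0) = {0..1}" "\<And>n. N (Suc n) \<in> children (N n)"
    "\<And>n. x \<in> snd (N n)" "\<And>n. N n \<in> net_intervals" "\<And>m. \<V> (N m) \<notin> essential_verts"
    using symbolic_representation_chain[OF e(1) assms] e(2) by blast
  have root: "(2, {0..1}) \<in> net_intervals" by (rule unit_net_interval) simp
  \<comment> \<open>The induction starts at the first child, since \<open>N 0\<close> may differ
    from the normalised root in its generation.\<close>
  have "((2, {0..1}), N (Suc n)) \<in> inessential_child ^^ Suc n" for n
  proof (induction n)
    case 0
    then show ?case using children_root[OF N(1,2)] N(3)[of 0] N(6)[of 1] root
      by (simp add: inessential_child_def)
  next
    case (Suc n)
    then show ?case using N(3)[of "Suc n"] N(5)[of "Suc n"] N(6)[of "Suc (Suc n)"]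
      by (auto simp: inessential_child_def simp del: relpow.simps intro: relpow_Suc_I)
  qed
  moreover have "((2, {0..1}), (2, {0..1})) \<in> inessential_child ^^ 0" "x \<in> snd (2, {0..1})"
    using N(2) N(4)[of 0] by auto
  ultimately have "\<exists>M. ((2, {0..1}), M) \<in> inessential_child ^^ n \<and> x \<in> snd M" for n
    using N(4) by (cases n) blast+
  then show "x \<in> {x. inessential_at x (2, {0..1})}" by (simp add: inessential_at_def)
next
  fix x assume "x \<in> {x. inessential_at x (2, {0..1})}"
  then have x: "inessential_at x (2, {0..1})" by simp
  \<comment> \<open>Dependent choice turns \<open>inessential_at_child\<close> into an infinite
    branch; the clause for \<open>n = 0\<close> pins its start to the root.\<close>
  have "\<exists>N. \<forall>n. (inessential_at x (N n) \<and> (n = 0 \<longrightarrow> N n = (2, {0..1}))) \<and>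
      (N n, N (Suc n)) \<in> inessential_child"
  proof (rule dependent_nat_choice)
    show "\<exists>N. inessential_at x N \<and> ((0 :: nat) = 0 \<longrightarrow> N = (2, {0..1}))" using x by blast
    show "\<exists>M. (inessential_at x M \<and> (Suc n = 0 \<longrightarrow> M = (2, {0..1}))) \<and> (N, M) \<in> inessential_child"
      if "inessential_at x N \<and> (n = 0 \<longrightarrow> N = (2, {0..1}))" for N n
      using inessential_at_child that by blast
  qed
  then obtain N where N: "\<And>n. inessential_at x (N n)" "N 0 = (2, {0..1})"
    "\<And>n. (N n, N (Suc n)) \<in> inessential_child" by blast
  have N0: "N 0 \<in> net_intervals" unfolding N(2) by (rule unit_net_interval) simp
  have ch: "N (Suc n) \<in> children (N n)" and ness: "\<V> (N (Suc n)) \<notin> essential_verts" for n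
    using N(3)[of n] by (auto simp: inessential_child_def)
  have xN: "x \<in> snd (N n)" for n
  proof -
    obtain M where "(N n, M) \<in> inessential_child ^^ 0" "x \<in> snd M"
      using N(1)[of n] unfolding inessential_at_def by blast
    then show ?thesis by simp
  qed
  have "x \<in> K" "(\<Inter>n. snd (N n)) = {x}" by (rule shrinking_net_intervals[of N, OF N0 ch xN])+
  then have rep: "symbolic_representation x (\<lambda>n. edge (N n) (N (Suc n)))"
    unfolding symbolic_representation_def using N(2) ch by (intro exI[of _ N]) auto
  have "edge (N k) (N (Suc k)) \<notin> arcs G_ess" for k
    using arc_G_ess[OF assms chain_net_interval[of N, OF N0 ch] ch] ness by blast
  with rep have "x \<notin> K_ess" unfolding K_ess_def by blast
  with \<open>x \<in> K\<close> show "x \<in> K - K_ess" by blast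
qed

lemma closed_K_diff_K_ess:
  assumes "essential_verts \<noteq> {}" shows "closed (K - K_ess)"
proof -
  let ?root = "(2, {0..1}) :: real \<times> real set"
  have root: "?root \<in> net_intervals" by (rule unit_net_interval) simp
  have "closed (snd M)" if "M \<in> net_intervals" for M
    using that by (auto elim!: net_intervalE)
  then have cl: "closed (\<Union>M\<in>{M. (?root, M) \<in> inessential_child ^^ n}. snd M)" for n
    using inessential_descendant_net[OF _ root] finite_inessential_descendants
    by (intro closed_UN) auto
  have eq: "K - K_ess = (\<Inter>n. \<Union>M\<in>{M. (?root, M) \<in> inessential_child ^^ n}. snd M)"
    unfolding K_diff_K_ess_eq[OF assms] inessential_at_def by blast
  show ?thesis unfolding eq by (intro closed_INT ballI cl)
qed

subsection \<open>Self-similar measures\<close>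

lemma continuous_S_word: "continuous_on A (S_word \<sigma>)"
proof -
  have "S_word \<sigma> = (\<lambda>x. r_word \<sigma> * x + S_word \<sigma> 0)" using S_word_affine by blast
  moreover have "continuous_on A (\<lambda>x. r_word \<sigma> * x + S_word \<sigma> 0)" by (intro continuous_intros)
  ultimately show ?thesis by metis
qed

lemma vimage_S_word_borel: "E \<in> sets borel \<Longrightarrow> S_word \<sigma> -` E \<in> sets borel"
  using measurable_sets[OF borel_measurable_continuous_onI[OF continuous_S_word]] by fastforce

lemma infdist_S_le:
  assumes "i \<in> I" shows "infdist (S i y) K \<le> \<bar>r i\<bar> * infdist y K"
proof -
  obtain k where k: "k \<in> K" "infdist y K = dist y k"
    using infdist_attains_inf[OF K_closed K_nonempty] by metis
  have "infdist (S i y) K \<le> dist (S i y) (S i k)"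
    using S_image_K[OF assms] k(1) by (intro infdist_le) auto
  also have "\<dots> = \<bar>r i\<bar> * dist y k" by (simp add: S_def dist_real_def abs_mult flip: right_diff_distrib)
  finally show ?thesis using k(2) by simp
qed

lemma infdist_sublevel_borel: "{y. infdist y K \<le> e} \<in> sets borel"
  by (intro borel_closed closed_Collect_le continuous_intros)

context
  fixes p :: "'i \<Rightarrow> real" and \<mu> :: "real measure"
  assumes ss: "self_similar_measure p \<mu>"
begin

interpretation prob_space \<mu>
  using ss by (simp add: self_similar_measure_def)

lemma p_pos: "i \<in> I \<Longrightarrow> 0 < p i"
  and p_sum: "sum p I = 1"
  and sets_\<mu>: "sets \<mu> = sets borel"
  and measure_\<mu>: "E \<in> sets borel \<Longrightarrow> measure \<mu> E = (\<Sum>i\<in>I. p i * measure \<mu> (S i -` E))"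
  using ss by (auto simp: self_similar_measure_def)

lemma space_\<mu>: "space \<mu> = UNIV"
  using sets_eq_imp_space_eq[OF sets_\<mu>] by simp

text \<open>Towards \<open>\<mu>\<close> living on \<open>K\<close>: each preimage of the
  \<open>e\<close>-neighbourhood contains the one of radius \<open>e / \<rho>\<close>, so by
  self-similarity the larger neighbourhood has no larger measure. The radii
  \<open>e / \<rho> ^ n\<close> exhaust the line.\<close>

lemma measure_neighbourhood:
  assumes "0 < e" shows "measure \<mu> {y. infdist y K \<le> e} = 1"
proof -
  let ?F = "\<lambda>e. {y. infdist y K \<le> e}"
  have F: "?F e \<in> sets borel" for e by (rule infdist_sublevel_borel)
  obtain \<rho> where \<rho>: "0 < \<rho>" "\<rho> < 1" "\<forall>i\<in>I. \<bar>r i\<bar> \<le> \<rho>" by (rule contraction_bound) blast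
  have step: "measure \<mu> (?F (e / \<rho>)) \<le> measure \<mu> (?F e)" for e
  proof -
    have "measure \<mu> (?F (e / \<rho>)) = (\<Sum>i\<in>I. p i * measure \<mu> (?F (e / \<rho>)))"
      using p_sum by (simp flip: sum_distrib_right)
    also have "\<dots> \<le> (\<Sum>i\<in>I. p i * measure \<mu> (S i -` ?F e))"
    proof (intro sum_mono mult_left_mono finite_measure_mono)
      fix i assume i: "i \<in> I"
      show "?F (e / \<rho>) \<subseteq> S i -` ?F e"
      proof
        fix y assume "y \<in> ?F (e / \<rho>)"
        then have "\<rho> * infdist y K \<le> e" using \<rho>(1) by (simp add: field_simps)
        moreover have "\<bar>r i\<bar> * infdist y K \<le> \<rho> * infdist y K"
          using \<rho>(3) i infdist_nonneg by (intro mult_right_mono) auto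
        ultimately show "y \<in> S i -` ?F e" using infdist_S_le[OF i, of y] by simp
      qed
      show "S i -` ?F e \<in> sets \<mu>" using vimage_S_word_borel[OF F, of "[i]" e] by (simp add: sets_\<mu>)
      show "0 \<le> p i" using p_pos[OF i] by simp
    qed
    also have "\<dots> = measure \<mu> (?F e)" using measure_\<mu>[OF F] by simp
    finally show ?thesis .
  qed
  have le: "measure \<mu> (?F (e / \<rho> ^ n)) \<le> measure \<mu> (?F e)" for n
  proof (induction n)
    case (Suc n)
    have "measure \<mu> (?F (e / \<rho> ^ Suc n)) \<le> measure \<mu> (?F (e / \<rho> ^ n))"
      using step[of "e / \<rho> ^ n"] by (simp add: mult.commute)
    with Suc.IH show ?case by simp
  qed simp
  have "incseq (\<lambda>n. ?F (e / \<rho> ^ n))"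
  proof (rule incseq_SucI, rule Collect_mono, rule impI)
    fix n y assume "infdist y K \<le> e / \<rho> ^ n"
    also have "\<dots> \<le> e / \<rho> ^ Suc n"
      using \<rho> assms by (intro divide_left_mono) (auto simp: mult_le_cancel_right1)
    finally show "infdist y K \<le> e / \<rho> ^ Suc n" .
  qed
  then have lim: "(\<lambda>n. measure \<mu> (?F (e / \<rho> ^ n))) \<longlonglongrightarrow> measure \<mu> (\<Union>n. ?F (e / \<rho> ^ n))"
    using F sets_\<mu> by (intro finite_Lim_measure_incseq) auto
  have "(\<Union>n. ?F (e / \<rho> ^ n)) = UNIV"
  proof -
    have "\<exists>n. infdist y K \<le> e / \<rho> ^ n" for y
    proof -
      obtain n where "infdist y K / e < (1 / \<rho>) ^ n" using real_arch_pow[of "1 / \<rho>"] \<rho> by auto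
      then show ?thesis using assms \<rho>(1) by (intro exI[of _ n]) (simp add: field_simps)
    qed
    then show ?thesis by auto
  qed
  then have "measure \<mu> (\<Union>n. ?F (e / \<rho> ^ n)) = 1" using prob_space space_\<mu> by simp
  then have "1 \<le> measure \<mu> (?F e)" using LIMSEQ_le_const2[OF lim] le by auto
  then show ?thesis using prob_le_1 by (meson antisym)
qed

lemma AE_in_K: "AE x in \<mu>. x \<in> K"
proof -
  have F: "{y. infdist y K \<le> e} \<in> sets \<mu>" for e unfolding sets_\<mu> by (rule infdist_sublevel_borel)
  have "AE y in \<mu>. infdist y K \<le> 1 / Suc n" for n
    using measure_neighbourhood[of "1 / Suc n"] prob_eq_1[OF F] by simp
  then have "AE y in \<mu>. \<forall>n. infdist y K \<le> 1 / Suc n" by (simp add: AE_all_countable)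
  then show ?thesis
  proof (rule AE_mp, intro AE_I2 impI)
    fix y assume *: "\<forall>n. infdist y K \<le> 1 / Suc n"
    have "infdist y K \<le> 0"
    proof (rule field_le_epsilon)
      fix e :: real assume "0 < e"
      then obtain n where "1 / Suc n < e" using nat_approx_posE by metis
      with * show "infdist y K \<le> 0 + e" by (metis add_0 less_imp_le order_trans)
    qed
    then show "y \<in> K"
      using in_closed_iff_infdist_zero[OF K_closed K_nonempty] infdist_nonneg[of y K] by auto
  qed
qed

lemma measure_mono_on_K:
  assumes "E \<in> sets borel" "F \<in> sets borel" "E \<inter> K \<subseteq> F"
  shows "measure \<mu> E \<le> measure \<mu> F"
  by (rule finite_measure_mono_AE) (use AE_in_K assms sets_\<mu> in auto)

text \<open>Self-similarity makes the measure of the preimage under \<open>S_word \<sigma>\<close>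
  an average over the one-letter extensions of \<open>\<sigma>\<close>. Each term is at most the
  measure of \<open>E\<close>, because \<open>\<mu>\<close> lives on \<open>K\<close>, so equality
  passes from \<open>\<sigma>\<close> to its extensions.\<close>

lemma measure_vimage_word:
  assumes E: "E \<in> sets borel" and inv: "\<And>\<sigma>. \<sigma> \<in> lists I \<Longrightarrow> S_word \<sigma> -` E \<inter> K \<subseteq> E"
    and \<sigma>: "\<sigma> \<in> lists I"
  shows "measure \<mu> (S_word \<sigma> -` E) = measure \<mu> E"
  using \<sigma>
proof (induction \<sigma> rule: rev_induct)
  case (snoc i \<sigma>)
  then have \<sigma>: "\<sigma> \<in> lists I" "i \<in> I" by auto
  let ?F = "S_word \<sigma> -` E"
  have eq: "S j -` ?F = S_word (\<sigma> @ [j]) -` E" for j by (auto simp: S_word_append)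
  have "measure \<mu> (S i -` ?F) = measure \<mu> E"
  proof (rule weighted_average_extremal[OF finite_I p_pos p_sum _ _ \<sigma>(2)])
    show "(\<Sum>i\<in>I. p i * measure \<mu> (S i -` ?F)) = measure \<mu> E"
      using measure_\<mu>[OF vimage_S_word_borel[OF E, of \<sigma>]] snoc.IH[OF \<sigma>(1)] by simp
    show "measure \<mu> (S j -` ?F) \<le> measure \<mu> E" if "j \<in> I" for j
      unfolding eq using \<sigma>(1) that
      by (intro measure_mono_on_K vimage_S_word_borel E inv) auto
  qed
  then show ?case by (simp add: eq)
qed simp

lemma null_K_diff_K_ess:
  assumes max: "max_ball x0 t0"
  shows "K - K_ess \<in> null_sets \<mu>"
proof -
  let ?B = "\<lambda>\<tau>. ball (S_word \<tau> x0) (\<bar>r_word \<tau>\<bar> * t0)"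
  let ?W = "\<Union>\<tau>\<in>lists I. ?B \<tau>"
  let ?E = "K - ?W"
  have "closed ?E" using K_closed by (intro closed_Diff) auto
  then have E: "?E \<in> sets borel" by (rule borel_closed)
  \<comment> \<open>Every ball in \<open>?W\<close> attains the supremum, so its points of
    \<open>K\<close> are interior essential.\<close>
  have "K - K_ess \<subseteq> ?E"
    using max_ball_K_ess[OF max_ball_image(2)[OF max]] by blast
  moreover have "measure \<mu> ?E = 0"
  proof -
    obtain x where x: "x \<in> K" "x \<in> ball x0 t0" using max_ball_meets_K[OF max] by blast
    obtain e where e: "0 < e" "ball x e \<subseteq> ball x0 t0" using x(2) openE[OF open_ball] by blast
    \<comment> \<open>This word sends all of \<open>K\<close> into the ball of the empty word, so
      the preimage of \<open>?E\<close> misses \<open>K\<close>.\<close>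
    obtain \<omega> where \<omega>: "\<omega> \<in> lists I" "\<And>y. y \<in> {0..1} \<Longrightarrow> \<bar>S_word \<omega> y - x\<bar> < e"
      using positive_word_near[OF x(1) e(1)] by metis
    \<comment> \<open>\<open>S_word \<tau>\<close> sends the ball of \<open>\<sigma>\<close> into
      the ball of \<open>\<tau> @ \<sigma>\<close>, so points of \<open>?W\<close> stay in
      \<open>?W\<close>.\<close>
    have "S_word \<tau> -` ?E \<inter> K \<subseteq> ?E" if \<tau>: "\<tau> \<in> lists I" for \<tau>
    proof -
      have "S_word \<tau> y \<in> ?W" if y: "y \<in> ?B \<sigma>" "\<sigma> \<in> lists I" for y \<sigma>
      proof -
        have "S_word \<tau> y \<in> ?B (\<tau> @ \<sigma>)"
          using y(1) S_word_in_ball[OF \<tau>, of y "S_word \<sigma> x0" "\<bar>r_word \<sigma>\<bar> * t0"]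
          by (simp add: S_word_append abs_mult mult.assoc)
        with \<tau> y(2) show ?thesis by (metis UN_I append_in_lists_conv)
      qed
      then show ?thesis by blast
    qed
    then have "measure \<mu> ?E = measure \<mu> (S_word \<omega> -` ?E)"
      using measure_vimage_word[OF E _ \<omega>(1)] by simp
    also have "\<dots> \<le> measure \<mu> {}"
    proof (rule measure_mono_on_K)
      have "S_word \<omega> y \<in> ?B []" if "y \<in> K" for y
      proof -
        have "S_word \<omega> y \<in> ball x e"
          using \<omega>(2)[of y] subsetD[OF K_subset that] by (simp add: dist_real_def abs_minus_commute)
        then show ?thesis using e(2) by auto
      qed
      then show "S_word \<omega> -` ?E \<inter> K \<subseteq> {}" by blast
    qed (use vimage_S_word_borel[OF E] in auto)
    finally show ?thesis by (simp add: measure_le_0_iff)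
  qed
  then have "?E \<in> null_sets \<mu>" using E sets_\<mu> by (simp add: null_sets_def emeasure_eq_measure)
  \<comment> \<open>\<open>\<mu>\<close> may be incomplete, so inclusion in a null set does not give
    measurability; closedness does.\<close>
  moreover have "K - K_ess \<in> sets \<mu>"
    unfolding sets_\<mu> by (intro borel_closed closed_K_diff_K_ess max_ball_essential_verts_nonempty[OF max])
  ultimately show ?thesis by (metis null_sets_subset)
qed

end

end

theorem theorem1p1:
  fixes I :: "'i set" and r d :: "'i \<Rightarrow> real" and K :: "real set"
  assumes "ifs I r d K"
    and "ifs.weak_separation I r d K"
  shows
    "(\<forall>x\<^sub>0 t\<^sub>0. 0 < t\<^sub>0 \<and>
        enat (card (ifs.maps_meeting I r d K t\<^sub>0 (ball x\<^sub>0 t\<^sub>0))) = ifs.separation_sup I r d K \<longrightarrow>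
        (\<exists>F. finite F \<and> (\<forall>N\<in>F. ifs.essential I r d K N) \<and> K \<inter> ball x\<^sub>0 t\<^sub>0 \<subseteq> (\<Union>N\<in>F. snd N)) \<and>
        K \<inter> ball x\<^sub>0 t\<^sub>0 \<subseteq> ifs.K_ess I r d K) \<and>
     (\<forall>p \<mu>. ifs.self_similar_measure I r d p \<mu> \<longrightarrow> K - ifs.K_ess I r d K \<in> null_sets \<mu>)"
proof -
  interpret ifs I r d K by (rule assms(1))
  \<comment> \<open>The claim on measures mentions no ball; weak separation supplies a maximal
    one.\<close>
  obtain x t where "max_ball x t" using exists_max_ball[OF assms(2)] .
  then have "\<forall>p \<mu>. self_similar_measure p \<mu> \<longrightarrow> K - K_ess \<in> null_sets \<mu>"
    using null_K_diff_K_ess by blast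
  moreover have "\<forall>x\<^sub>0 t\<^sub>0. 0 < t\<^sub>0 \<and> enat (card (maps_meeting t\<^sub>0 (ball x\<^sub>0 t\<^sub>0))) = separation_sup \<longrightarrow>
      (\<exists>F. finite F \<and> (\<forall>N\<in>F. essential N) \<and> K \<inter> ball x\<^sub>0 t\<^sub>0 \<subseteq> (\<Union>N\<in>F. snd N)) \<and>
      K \<inter> ball x\<^sub>0 t\<^sub>0 \<subseteq> K_ess"
    unfolding max_ball_def[symmetric] using max_ball_cover max_ball_K_ess by (intro allI impI conjI)
  ultimately show ?thesis by (intro conjI)
qed

end
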